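(* Assume: (A1) $\psi$ is proper, closed and convex, $\mathrm{dom}(F)\neq\emptyset$, and $F^\star:=\inf_x F(x)>-\infty$; (A2) $\mathbb{E}_\xi[\|\nabla f_\xi(x)-\nabla f_\xi(y)\|^2]\le L^2\|x-y\|^2$ for all $x,y\in\mathrm{dom}(F)$, with $L\in(0,\infty)$; (A3) $\mathbb{E}_\xi[\|\nabla f_\xi(x)-\nabla f(x)\|^2]\le\sigma^2$ for all $x\in\mathrm{dom}(F)$, with $\sigma\in[0,\infty)$. Let $\{x_t\}_{t=0}^m$ be generated by the mini-batch ProxHSGD algorithm (see context, with mini-batch sizes $b,\hat b\in\mathbb{N}_+$ and initial batch size $\tilde b\in\mathbb{N}_+$) applied to $\min_xF(x)$ with $$\beta_t=\beta:=1-\frac{\hat b^{1/2}}{[\tilde b(m+1)]^{1/2}},\qquad \gamma_t=\gamma:=\frac{3c_0\,\hat b^{1/4}b^{1/2}}{\sqrt{13}\,[\tilde b(m+1)]^{1/4}},\qquad \eta_t=\eta:=\frac{2}{L(3+\gamma)},$$ where $1\le\hat b\le\tilde b(m+1)$ and $0<c_0\le\frac{\sqrt{13}}{3b^{1/2}}$ is given. Then: (a) $\beta\in[0,1)$, $\gamma\in(0,1]$, and $\frac1{2L}\le\eta\le\frac2{3L}$. (b) If $\overline{x}_m$ is chosen uniformly at random from $\{x_t\}_{t=0}^m$, then $$\mathbb{E}\big[\|\mathcal{G}_\eta(\overline{x}_m)\|^2\big]\le\frac{16\sqrt{13}\,L\,\tilde b^{1/4}[F(x_0)-F^\star]}{3c_0\,\hat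 b^{1/4}b^{1/2}(m+1)^{3/4}}+\frac{208\,\sigma^2}{9\big[\hat b\tilde b(m+1)\big]^{1/2}}.$$ (c) Choose $\hat b=b\in\mathbb{N}_+$ and $\tilde b:=c_1^2[b(m+1)]^{1/3}$ for some $c_1\ge\frac{b^{1/3}}{(m+1)^{2/3}}$. Then $\gamma=\frac{3c_0b^{2/3}}{\sqrt{13c_1}(m+1)^{1/3}}$. Moreover, for any $\varepsilon>0$, the number of iterations $m$ needed to obtain $\mathbb{E}[\|\mathcal{G}_\eta(\overline{x}_m)\|^2]\le\varepsilon^2$ is at most $$m:=\Big\lfloor\frac{\Delta_0^{3/2}}{b\,\varepsilon^3}\Big\rfloor,\qquad \Delta_0:=\frac{16}{3}\Big[\frac{\sqrt{13c_1}\,L[F(x_0)-F^\star]}{c_0}+\frac{13\sigma^2}{3c_1}\Big].$$ This is also the total number $\mathcal{T}_{\mathrm{prox}}$ of proximal operations $\mathrm{prox}_{\eta\psi}$, i.e. $\mathcal{T}_{\mathrm{prox}}=m$. The total number of stochastic gradient evaluations is at most $$\mathcal{T}_m:=\Big\lfloor\frac{c_1^2\Delta_0^{1/2}}{\varepsilon}+\frac{3\Delta_0^{3/2}}{\varepsilon^3}\Big\rfloor.$$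
   Context: Problem: minimize $F(x):=f(x)+\psi(x)$ over $x\in\mathbb{R}^p$, where $f(x)=\mathbb{E}_{\xi\sim\mathbb{P}}[f_\xi(x)]$, each $f_\xi:\mathbb{R}^p\to\mathbb{R}$ is smooth (possibly nonconvex), stochastic gradients are unbiased ($\mathbb{E}_\xi[\nabla f_\xi(x)]=\nabla f(x)$), and $\psi:\mathbb{R}^p\to\mathbb{R}\cup\{+\infty\}$. Proximal operator: $\mathrm{prox}_{\eta\psi}(x):=\arg\min_u\{\eta\psi(u)+\frac12\|u-x\|^2\}$. Gradient mapping: $\mathcal{G}_\eta(x):=\frac1\eta\big(x-\mathrm{prox}_{\eta\psi}(x-\eta\nabla f(x))\big)$. Mini-batch ProxHSGD algorithm: given $x_0\in\mathrm{dom}(F)$ (deterministic), compute $\hat v_0:=\frac1{\tilde b}\sum_{\tilde\xi_i\in\widetilde{\mathcal{B}}}\nabla f_{\tilde\xi_i}(x_0)$ with $\widetilde{\mathcal B}$ a batch of $\tilde b$ i.i.d. samples of $\xi$; set $\widehat{x}_1:=\mathrm{prox}_{\eta_0\psi}(x_0-\eta_0\hat v_0)$ and $x_1:=(1-\gamma_0)x_0+\gamma_0\widehat{x}_1$. For $t=1,\dots,m$: draw independent mini-batches $\mathcal{B}_t$ (of $b$ i.i.d. samples of $\xi$) and $\hat{\mathcal{B}}_t$ (of $\hat b$ i.i.d. samples of $\xi$), independent of the past; set $$\hat v_t:=\beta\hat v_{t-1}+\frac{\beta}{b}\sum_{\xi_t\in\mathcal{B}_t}\big(\nabla f_{\xi_t}(x_t)-\nabla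 f_{\xi_t}(x_{t-1})\big)+\frac{1-\beta}{\hat b}\sum_{\zeta_t\in\hat{\mathcal{B}}_t}\nabla f_{\zeta_t}(x_t);$$ set $\widehat{x}_{t+1}:=\mathrm{prox}_{\eta_t\psi}(x_t-\eta_t\hat v_t)$ and $x_{t+1}:=(1-\gamma_t)x_t+\gamma_t\widehat{x}_{t+1}$. $\mathbb{E}[\cdot]$ is expectation over all randomness, including the independent random choice of $\overline{x}_m$. Convention on counts in (c): integer rounding is ignored, i.e. $\tilde b$ and $m+1$ are identified with the real expressions given ($b(m+1)=\Delta_0^{3/2}/\varepsilon^3$), the number of proximal operations is identified with the number of iterations, and the number of stochastic gradient evaluations is counted as $\tilde b+3b(m+1)$. *)

theory Defs
  imports "HOL-Probability.Probability"
begin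

definition grad :: "('a::euclidean_space \<Rightarrow> real) \<Rightarrow> 'a \<Rightarrow> 'a" where
  "grad f x = (THE D. GDERIV f x :> D)"

definition ext_epigraph :: "('a \<Rightarrow> ereal) \<Rightarrow> ('a \<times> real) set" where
  "ext_epigraph \<psi> = {(x, r). \<psi> x \<le> ereal r}"

definition ext_dom :: "('a \<Rightarrow> ereal) \<Rightarrow> 'a set" where
  "ext_dom F = {x. F x < \<infinity>}"

definition proper_fun :: "('a \<Rightarrow> ereal) \<Rightarrow> bool" where
  "proper_fun \<psi> \<longleftrightarrow> (\<forall>x. \<psi> x \<noteq> -\<infinity>) \<and> ext_dom \<psi> \<noteq> {}"

definition closed_fun :: "('a::topological_space \<Rightarrow> ereal) \<Rightarrow> bool" where
  "closed_fun \<psi> \<longleftrightarrow> closed (ext_epigraph \<psi>)"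

definition convex_fun :: "('a::real_vector \<Rightarrow> ereal) \<Rightarrow> bool" where
  "convex_fun \<psi> \<longleftrightarrow> convex (ext_epigraph \<psi>)"

definition prox :: "real \<Rightarrow> ('a::euclidean_space \<Rightarrow> ereal) \<Rightarrow> 'a \<Rightarrow> 'a" where
  "prox \<eta> \<psi> x = (ARG_MIN (\<lambda>u. ereal \<eta> * \<psi> u + ereal ((norm (u - x))\<^sup>2 / 2)) u. True)"

definition grad_map ::
  "real \<Rightarrow> ('a::euclidean_space \<Rightarrow> ereal) \<Rightarrow> ('a \<Rightarrow> real) \<Rightarrow> 'a \<Rightarrow> 'a" where
  "grad_map \<eta> \<psi> f x = (1 / \<eta>) *\<^sub>R (x - prox \<eta> \<psi> (x - \<eta> *\<^sub>R grad f x))"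

text \<open>
  The library's \<open>prob_space.indep_var\<close> forces both random variables to have the same value type;
  this is its characterisation \<open>prob_space.indep_var_eq\<close> with different value types.
\<close>

definition indep_rvs ::
  "'w measure \<Rightarrow> 'a measure \<Rightarrow> ('w \<Rightarrow> 'a) \<Rightarrow> 'b measure \<Rightarrow> ('w \<Rightarrow> 'b) \<Rightarrow> bool" where
  "indep_rvs M A X B Y \<longleftrightarrow>
     X \<in> measurable M A \<and> Y \<in> measurable M B \<and>
     prob_space.indep_set M
       (sigma_sets (space M) {X -` C \<inter> space M | C. C \<in> sets A})
       (sigma_sets (space M) {Y -` C \<inter> space M | C. C \<in> sets B})"

text \<open>
  Names of the individual samples drawn by the algorithm: \<open>Init i\<close> is the \<open>i\<close>-th sample of the
  initial batch, \<open>Batch t i\<close> and \<open>Batch_hat t i\<close> are the \<open>i\<close>-th samples of the two mini-batches of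
  iteration \<open>t\<close>.
\<close>

datatype sample_index = Init nat | Batch nat nat | Batch_hat nat nat

definition sample_indices :: "nat \<Rightarrow> nat \<Rightarrow> nat \<Rightarrow> nat \<Rightarrow> sample_index set" where
  "sample_indices bt b bh m =
     {Init i | i. i < bt} \<union> {Batch t i | t i. 1 \<le> t \<and> t \<le> m \<and> i < b}
       \<union> {Batch_hat t i | t i. 1 \<le> t \<and> t \<le> m \<and> i < bh}"

text \<open>
  The iterates \<open>x\<^sub>t\<close> and the gradient estimators \<open>v\<^sub>t\<close>, pathwise, as functions of a realisation \<open>s\<close>
  of all samples; \<open>g \<xi>\<close> is the stochastic gradient at the sample \<open>\<xi>\<close>, and \<open>bt\<close>, \<open>b\<close>, \<open>bh\<close> are the
  sizes of the initial batch and of the two mini-batches.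
\<close>

fun hsgd_x ::
  "('s \<Rightarrow> 'a::euclidean_space \<Rightarrow> 'a) \<Rightarrow> ('a \<Rightarrow> ereal) \<Rightarrow> 'a \<Rightarrow> nat \<Rightarrow> nat \<Rightarrow> nat \<Rightarrow>
    (nat \<Rightarrow> real) \<Rightarrow> (nat \<Rightarrow> real) \<Rightarrow> (nat \<Rightarrow> real) \<Rightarrow> (sample_index \<Rightarrow> 's) \<Rightarrow> nat \<Rightarrow> 'a"
and hsgd_v ::
  "('s \<Rightarrow> 'a::euclidean_space \<Rightarrow> 'a) \<Rightarrow> ('a \<Rightarrow> ereal) \<Rightarrow> 'a \<Rightarrow> nat \<Rightarrow> nat \<Rightarrow> nat \<Rightarrow>
    (nat \<Rightarrow> real) \<Rightarrow> (nat \<Rightarrow> real) \<Rightarrow> (nat \<Rightarrow> real) \<Rightarrow> (sample_index \<Rightarrow> 's) \<Rightarrow> nat \<Rightarrow> 'a"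
where
  "hsgd_x g \<psi> x0 bt b bh \<beta> \<gamma> \<eta> s 0 = x0"
| "hsgd_x g \<psi> x0 bt b bh \<beta> \<gamma> \<eta> s (Suc t) =
     (1 - \<gamma> t) *\<^sub>R hsgd_x g \<psi> x0 bt b bh \<beta> \<gamma> \<eta> s t
     + \<gamma> t *\<^sub>R prox (\<eta> t) \<psi>
         (hsgd_x g \<psi> x0 bt b bh \<beta> \<gamma> \<eta> s t - \<eta> t *\<^sub>R hsgd_v g \<psi> x0 bt b bh \<beta> \<gamma> \<eta> s t)"
| "hsgd_v g \<psi> x0 bt b bh \<beta> \<gamma> \<eta> s 0 = (1 / real bt) *\<^sub>R (\<Sum>i<bt. g (s (Init i)) x0)"
| "hsgd_v g \<psi> x0 bt b bh \<beta> \<gamma> \<eta> s (Suc t) =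
     \<beta> (Suc t) *\<^sub>R hsgd_v g \<psi> x0 bt b bh \<beta> \<gamma> \<eta> s t
     + (\<beta> (Suc t) / real b) *\<^sub>R
         (\<Sum>i<b. g (s (Batch (Suc t) i)) (hsgd_x g \<psi> x0 bt b bh \<beta> \<gamma> \<eta> s (Suc t))
                - g (s (Batch (Suc t) i)) (hsgd_x g \<psi> x0 bt b bh \<beta> \<gamma> \<eta> s t))
     + ((1 - \<beta> (Suc t)) / real bh) *\<^sub>R
         (\<Sum>i<bh. g (s (Batch_hat (Suc t) i)) (hsgd_x g \<psi> x0 bt b bh \<beta> \<gamma> \<eta> s (Suc t)))"

text \<open>
  Counting conventions: proximal operations are identified with the iterations \<open>t = 1, \<dots>, m\<close>
  (one per iteration), and with mini-batches of common size \<open>b\<close> every one of \<open>M = m + 1\<close> rounds is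
  charged \<open>3 b\<close> stochastic gradients. The arguments of the second count are real, so that it can be
  evaluated with integer rounding ignored.
\<close>

definition prox_count :: "nat \<Rightarrow> nat" where
  "prox_count m = card {1..m}"

definition grad_count :: "real \<Rightarrow> real \<Rightarrow> real \<Rightarrow> real" where
  "grad_count bt b M = bt + 3 * b * M"

end

theory Submission
  imports Defs
begin

text \<open>
  Write \<open>e\<^sub>t = \<parallel>v\<^sub>t - \<nabla>f(x\<^sub>t)\<parallel>\<^sup>2\<close> and \<open>d\<^sub>t = \<parallel>prox(x\<^sub>t - \<eta> v\<^sub>t) - x\<^sub>t\<parallel>\<^sup>2\<close>.
  The descent lemma on the convex domain of \<open>\<psi>\<close>, the variational inequality of the proximal point and
  the choice of \<open>\<eta>\<close> give, for every realisation of the samples,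
  \<open>F(x\<^sub>t\<^sub>+\<^sub>1) + \<gamma> (L d\<^sub>t - e\<^sub>t / (2 L)) \<le> F(x\<^sub>t)\<close>; working pathwise here avoids any measurability question
  about \<open>\<psi>\<close>. The error \<open>v\<^sub>t\<^sub>+\<^sub>1 - \<nabla>f(x\<^sub>t\<^sub>+\<^sub>1)\<close> is \<open>\<beta> (v\<^sub>t - \<nabla>f(x\<^sub>t))\<close> plus one centred increment per fresh
  sample, and these are pairwise orthogonal, so that
  \<open>E e\<^sub>t\<^sub>+\<^sub>1 \<le> \<beta>\<^sup>2 E e\<^sub>t + \<beta>\<^sup>2 L\<^sup>2 \<gamma>\<^sup>2 / b E d\<^sub>t + (1 - \<beta>)\<^sup>2 \<sigma>\<^sup>2 / bh\<close>. The parameters satisfy \<open>\<gamma>\<^sup>2 \<le> b (1 - \<beta>)\<close>, which lets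
  the two summed inequalities absorb each other, and nonexpansiveness of the proximal map bounds the
  squared gradient mapping by \<open>8 L\<^sup>2 d\<^sub>t + 2 e\<^sub>t\<close>.
\<close>

section \<open>Gradients and proximal points\<close>

text \<open>The increments of a round are orthogonal only given the past, yet no conditional
  expectation is formed. Iterates are functions of a realisation of the samples; the law of the past
  is paired with \<open>P\<close> for one fresh sample, and Fubini reduces the claim to a centred
  variable added to a fixed vector. This needs the gradient to be jointly measurable in sample and
  point, which its continuity in the point supplies. Integrability of the error and of the step is
  not assumed either. The recursion bounds the next error by the current error and step, while the
  pathwise decrease together with the lower bound on the objective bounds a step by the errors so
  far; an induction alternates between the two. The summed inequalities can absorb each other
  because the coupling is weak: half the error sum enters the bound on \<open>L\<^sup>2\<close>
  times the step sum, and half of the latter enters the bound on the former, so the product of the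
  two factors is 1/4 < 1.\<close>

lemma gderiv_grad:
  fixes f :: "'a::euclidean_space \<Rightarrow> real"
  assumes "f differentiable at x"
  shows "GDERIV f x :> grad f x"
proof -
  from assms obtain f' where f': "(f has_derivative f') (at x)"
    unfolding differentiable_def by blast
  interpret bounded_linear f' using f' by (rule has_derivative_bounded_linear)
  let ?D = "\<Sum>b\<in>Basis. f' b *\<^sub>R b"
  have "f' h = h \<bullet> ?D" for h
  proof -
    have "f' h = f' (\<Sum>b\<in>Basis. (h \<bullet> b) *\<^sub>R b)" by (simp add: euclidean_representation)
    also have "\<dots> = (\<Sum>b\<in>Basis. (h \<bullet> b) * f' b)" by (simp add: sum scaleR)
    also have "\<dots> = h \<bullet> ?D" by (simp add: inner_sum_right mult.commute)
    finally show ?thesis .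
  qed
  then have "f' = (\<lambda>h. h \<bullet> ?D)" by (rule ext)
  with f' have D: "GDERIV f x :> ?D" by (simp add: gderiv_def)
  \<comment> \<open>\<open>grad\<close> is a definite description, so a gradient must also be
    unique; two candidates are compared by testing in the direction of their difference.\<close>
  have "D' = ?D" if "GDERIV f x :> D'" for D'
  proof -
    have "(\<lambda>h. h \<bullet> D') = (\<lambda>h. h \<bullet> ?D)"
      using that D unfolding gderiv_def by (rule has_derivative_unique)
    then have "(D' - ?D) \<bullet> D' = (D' - ?D) \<bullet> ?D" by (rule fun_cong)
    then have "(D' - ?D) \<bullet> (D' - ?D) = 0" by (simp add: inner_diff_right)
    then show ?thesis by simp
  qed
  with D show ?thesis unfolding grad_def by (rule theI)
qed

text \<open>The gradient is known to be Lipschitz only on the domain of \<open>\<psi>\<close>, so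
  the argument stays on a segment inside a convex set \<open>C\<close>.\<close>

lemma descent_lemma:
  fixes f :: "'a::real_inner \<Rightarrow> real"
  assumes "convex C" and xy: "x \<in> C" "y \<in> C"
    and G: "\<And>z. z \<in> C \<Longrightarrow> GDERIV f z :> G z"
    and lip: "\<And>y z. y \<in> C \<Longrightarrow> z \<in> C \<Longrightarrow> norm (G y - G z) \<le> L * norm (y - z)"
  shows "f y \<le> f x + G x \<bullet> (y - x) + L / 2 * (norm (y - x))\<^sup>2"
proof -
  define h where "h = y - x"
  \<comment> \<open>\<open>\<phi>\<close> is \<open>f\<close> minus the linear term and the
    quadratic term along the segment; comparing its endpoints is the claim.\<close>
  define \<phi> where "\<phi> s = f (x + s *\<^sub>R h) - s * (G x \<bullet> h) - L * s\<^sup>2 / 2 * (norm h)\<^sup>2" for s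
  have seg: "x + s *\<^sub>R h \<in> C" if "0 \<le> s" "s \<le> 1" for s
    using convexD_alt[OF assms(1) xy, of s] that by (simp add: h_def algebra_simps)
  have "\<phi> 1 \<le> \<phi> 0"
  proof (rule DERIV_nonpos_imp_nonincreasing[of 0 1])
    fix s :: real assume s: "0 \<le> s" "s \<le> 1"
    let ?z = "x + s *\<^sub>R h"
    have "((\<lambda>s. f (x + s *\<^sub>R h)) has_derivative (\<lambda>t. (t *\<^sub>R h) \<bullet> G ?z)) (at s)"
    proof (rule has_derivative_compose[where f = "\<lambda>s. x + s *\<^sub>R h"])
      show "(f has_derivative (\<lambda>v. v \<bullet> G ?z)) (at ?z)"
        using G[OF seg[OF s]] by (simp add: gderiv_def)
    qed (auto intro!: derivative_eq_intros)
    then have "((\<lambda>s. f (x + s *\<^sub>R h)) has_real_derivative (h \<bullet> G ?z)) (at s)"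
      by (simp add: has_field_derivative_def mult.commute[of _ "h \<bullet> G ?z"])
    then have "(\<phi> has_real_derivative (h \<bullet> G ?z - G x \<bullet> h - L * s * (norm h)\<^sup>2)) (at s)"
      unfolding \<phi>_def by (auto intro!: derivative_eq_intros)
    moreover have "h \<bullet> G ?z - G x \<bullet> h - L * s * (norm h)\<^sup>2 \<le> 0"
    proof -
      have "h \<bullet> G ?z - G x \<bullet> h = h \<bullet> (G ?z - G x)"
        by (simp add: inner_diff_right inner_commute)
      also have "\<dots> \<le> norm h * norm (G ?z - G x)" by (rule norm_cauchy_schwarz)
      also have "\<dots> \<le> norm h * (L * norm (?z - x))"
        by (intro mult_left_mono lip seg s xy) auto
      also have "\<dots> = L * s * (norm h)\<^sup>2" using s by (simp add: power2_eq_square)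
      finally show ?thesis by simp
    qed
    ultimately show "\<exists>D. (\<phi> has_real_derivative D) (at s) \<and> D \<le> 0" by blast
  qed auto
  then show ?thesis by (simp add: \<phi>_def h_def)
qed

section \<open>Extended-valued convex functions and their proximal points\<close>

lemma proper_fun_finite:
  assumes "proper_fun \<psi>" "u \<in> ext_dom \<psi>"
  shows "ereal (real_of_ereal (\<psi> u)) = \<psi> u"
  using assms by (cases "\<psi> u") (auto simp: proper_fun_def ext_dom_def)

text \<open>\<open>real_of_ereal\<close> maps an infinite value to 0, so the real inequality has
  content only where \<open>\<psi>\<close> is finite. Convexity of the epigraph at two graph points
  gives a finite upper bound in between, hence a convex domain, and only then the
  inequality.\<close>

lemma convex_fun_imp_convex_on:
  fixes \<psi> :: "'a::real_vector \<Rightarrow> ereal"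
  assumes "proper_fun \<psi>" "convex_fun \<psi>"
  shows "convex_on (ext_dom \<psi>) (\<lambda>u. real_of_ereal (\<psi> u))"
proof -
  have *: "\<psi> ((1 - t) *\<^sub>R x + t *\<^sub>R y)
      \<le> ereal ((1 - t) * real_of_ereal (\<psi> x) + t * real_of_ereal (\<psi> y))"
    if "0 \<le> t" "t \<le> 1" "x \<in> ext_dom \<psi>" "y \<in> ext_dom \<psi>" for t x y
  proof -
    have "(x, real_of_ereal (\<psi> x)) \<in> ext_epigraph \<psi>" "(y, real_of_ereal (\<psi> y)) \<in> ext_epigraph \<psi>"
      using that assms(1) by (simp_all add: ext_epigraph_def proper_fun_finite)
    from convexD_alt[OF assms(2)[unfolded convex_fun_def] this that(1,2)]
    show ?thesis by (simp add: ext_epigraph_def)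
  qed
  show ?thesis
  proof (rule convex_onI)
    show "convex (ext_dom \<psi>)"
      unfolding convex_alt ext_dom_def
      using * by (force simp: ext_dom_def intro: le_less_trans)
    fix t :: real and x y assume t: "0 < t" "t < 1" "x \<in> ext_dom \<psi>" "y \<in> ext_dom \<psi>"
    then have "(1 - t) *\<^sub>R x + t *\<^sub>R y \<in> ext_dom \<psi>"
      using *[of t x y] by (auto simp: ext_dom_def intro: le_less_trans)
    then obtain r where "\<psi> ((1 - t) *\<^sub>R x + t *\<^sub>R y) = ereal r"
      using proper_fun_finite[OF assms(1)] by metis
    with *[of t x y] t show "real_of_ereal (\<psi> ((1 - t) *\<^sub>R x + t *\<^sub>R y))
        \<le> (1 - t) * real_of_ereal (\<psi> x) + t * real_of_ereal (\<psi> y)"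
      by simp
  qed
qed

text \<open>Supplies coercivity: a function that decreases at most linearly cannot outweigh the
  quadratic term of the proximal objective.\<close>

lemma affine_minorant:
  fixes \<psi> :: "'a::euclidean_space \<Rightarrow> ereal"
  assumes "proper_fun \<psi>" "closed_fun \<psi>" "convex_fun \<psi>"
  obtains a k where "\<And>u r. (u, r) \<in> ext_epigraph \<psi> \<Longrightarrow> k + a \<bullet> u \<le> r"
proof -
  obtain v where v: "v \<in> ext_dom \<psi>" using assms(1) by (auto simp: proper_fun_def)
  define q where "q = real_of_ereal (\<psi> v)"
  have q: "\<psi> v = ereal q" using proper_fun_finite[OF assms(1) v] by (simp add: q_def)
  \<comment> \<open>A point below the graph is separated from the closed convex epigraph. The graph
    point above it lies on the other side, which makes the last component of the normal positive, so
    the hyperplane is not vertical.\<close>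
  have "(v, q - 1) \<notin> ext_epigraph \<psi>" by (simp add: ext_epigraph_def q)
  with separating_hyperplane_closed_point[of "ext_epigraph \<psi>" "(v, q - 1)"] assms(2,3)
  obtain c d where cd: "c \<bullet> (v, q - 1) < d" "\<And>z. z \<in> ext_epigraph \<psi> \<Longrightarrow> d < c \<bullet> z"
    unfolding closed_fun_def convex_fun_def by blast
  obtain a \<alpha> where c: "c = (a, \<alpha>)" by (cases c)
  have "d < c \<bullet> (v, q)" by (rule cd) (simp add: ext_epigraph_def q)
  with cd(1) have \<alpha>: "\<alpha> > 0" by (simp add: c algebra_simps)
  show ?thesis
  proof (rule that)
    fix u r assume "(u, r) \<in> ext_epigraph \<psi>"
    from cd(2)[OF this] have "d < a \<bullet> u + \<alpha> * r" by (simp add: c)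
    then show "d / \<alpha> + (- (1 / \<alpha>) *\<^sub>R a) \<bullet> u \<le> r"
      using \<alpha> by (simp add: field_simps)
  qed
qed

text \<open>\<open>prox\<close> is a choice among minimisers, so the content is that one exists. The
  problem is lifted to the epigraph, where the objective becomes the continuous real function
  \<open>\<Phi>\<close> and closedness of \<open>\<psi>\<close> makes the sublevel set
  closed.\<close>

lemma prox_is_arg_min:
  fixes \<psi> :: "'a::euclidean_space \<Rightarrow> ereal"
  assumes \<psi>: "proper_fun \<psi>" "closed_fun \<psi>" "convex_fun \<psi>" and \<eta>: "\<eta> > 0"
  shows "ereal \<eta> * \<psi> (prox \<eta> \<psi> x) + ereal ((norm (prox \<eta> \<psi> x - x))\<^sup>2 / 2)
      \<le> ereal \<eta> * \<psi> u + ereal ((norm (u - x))\<^sup>2 / 2)"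
proof -
  let ?E = "ext_epigraph \<psi>"
  define \<Phi> where "\<Phi> = (\<lambda>z::'a \<times> real. \<eta> * snd z + (norm (fst z - x))\<^sup>2 / 2)"
  have cont: "continuous_on A \<Phi>" for A unfolding \<Phi>_def by (intro continuous_intros) auto
  from affine_minorant[OF \<psi>] obtain a k
    where ak: "\<And>u r. (u, r) \<in> ?E \<Longrightarrow> k + a \<bullet> u \<le> r" by metis
  obtain v where v: "v \<in> ext_dom \<psi>" using \<psi>(1) by (auto simp: proper_fun_def)
  define q where "q = real_of_ereal (\<psi> v)"
  have vq: "(v, q) \<in> ?E"
    using proper_fun_finite[OF \<psi>(1) v] by (simp add: ext_epigraph_def q_def)
  define c where "c = \<Phi> (v, q)"
  define C where "C = ?E \<inter> {z. \<Phi> z \<le> c}"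
  \<comment> \<open>Completing the square after inserting the affine minorant moves the centre from
    \<open>x\<close> to \<open>x - \<eta> *\<^sub>R a\<close>; \<open>K\<close> is the resulting
    bound on the squared distance to it.\<close>
  define K where "K = 2 * (c - \<eta> * k - \<eta> * (a \<bullet> x)) + \<eta>\<^sup>2 * (norm a)\<^sup>2"
  define R where "R = norm (x - \<eta> *\<^sub>R a) + sqrt K"
  have "C \<subseteq> cball 0 R \<times> {k - norm a * R..c / \<eta>}"
  proof
    fix z assume z: "z \<in> C"
    obtain u r where ur: "z = (u, r)" by (cases z)
    from z ur have E: "(u, r) \<in> ?E" and \<Phi>: "\<eta> * r + (norm (u - x))\<^sup>2 / 2 \<le> c"
      by (auto simp: C_def \<Phi>_def)
    have "\<eta> * (k + a \<bullet> u) \<le> \<eta> * r" using ak[OF E] \<eta> by simp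
    with \<Phi> have "\<eta> * (k + a \<bullet> u) + (norm (u - x))\<^sup>2 / 2 \<le> c" by linarith
    moreover have "(norm (u - (x - \<eta> *\<^sub>R a)))\<^sup>2
        = (norm (u - x))\<^sup>2 + 2 * \<eta> * (a \<bullet> u) - 2 * \<eta> * (a \<bullet> x) + \<eta>\<^sup>2 * (norm a)\<^sup>2"
      unfolding power2_norm_eq_inner
      by (simp add: inner_diff_left inner_diff_right inner_commute algebra_simps power2_eq_square)
    ultimately have "(norm (u - (x - \<eta> *\<^sub>R a)))\<^sup>2 \<le> K"
      by (simp add: K_def algebra_simps)
    then have "norm (u - (x - \<eta> *\<^sub>R a)) \<le> sqrt K" by (rule real_le_rsqrt)
    then have u: "norm u \<le> R"
      using norm_triangle_sub[of u "x - \<eta> *\<^sub>R a"] by (simp add: R_def)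
    have "\<bar>a \<bullet> u\<bar> \<le> norm a * R"
      by (rule order_trans[OF Cauchy_Schwarz_ineq2 mult_left_mono[OF u]]) simp
    with ak[OF E] have "k - norm a * R \<le> r" by linarith
    moreover have "\<eta> * r \<le> c" using \<Phi> zero_le_power2[of "norm (u - x)"] by linarith
    then have "r \<le> c / \<eta>" using \<eta> by (simp add: field_simps)
    ultimately show "z \<in> cball 0 R \<times> {k - norm a * R..c / \<eta>}" using u by (simp add: ur)
  qed
  then have "bounded C"
    by (rule bounded_subset[rotated]) (intro bounded_Times bounded_cball bounded_closed_interval)
  moreover have "closed C"
    unfolding C_def using \<psi>(2)
    by (intro closed_Int closed_Collect_le cont continuous_on_const) (simp add: closed_fun_def)
  ultimately have "compact C" by (simp add: compact_eq_bounded_closed)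
  moreover have "(v, q) \<in> C" using vq by (simp add: C_def c_def)
  ultimately obtain z where z: "z \<in> C" "\<And>z'. z' \<in> C \<Longrightarrow> \<Phi> z \<le> \<Phi> z'"
    using continuous_attains_inf[OF _ _ cont, of C] by blast
  obtain p r where pr: "z = (p, r)" by (cases z)
  have min: "\<Phi> (p, r) \<le> \<Phi> z'" if "z' \<in> ?E" for z'
    using z that unfolding pr C_def by (cases "\<Phi> z' \<le> c") auto
  let ?obj = "\<lambda>u. ereal \<eta> * \<psi> u + ereal ((norm (u - x))\<^sup>2 / 2)"
  have "?obj p \<le> ?obj u" for u
  proof (cases "\<psi> u = \<infinity>")
    case True
    then show ?thesis using \<eta> by simp
  next
    case False
    then have "u \<in> ext_dom \<psi>" by (simp add: ext_dom_def top.not_eq_extremum[symmetric])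
    from proper_fun_finite[OF \<psi>(1) this] obtain s where s: "\<psi> u = ereal s" by metis
    \<comment> \<open>The minimising pair may lie above the graph; replacing \<open>r\<close> by
      \<open>\<psi> p\<close> can only lower the objective.\<close>
    have "(p, r) \<in> ?E" using z by (simp add: C_def pr)
    then have pr': "\<psi> p \<le> ereal r" by (simp add: ext_epigraph_def)
    have "ereal \<eta> * \<psi> p \<le> ereal (\<eta> * r)"
      using ereal_mult_left_mono[OF pr', of "ereal \<eta>"] \<eta> by simp
    then have "?obj p \<le> ereal (\<Phi> (p, r))" unfolding \<Phi>_def
      using add_right_mono[of "ereal \<eta> * \<psi> p" "ereal (\<eta> * r)" "ereal ((norm (p - x))\<^sup>2 / 2)"] by simp
    also have "\<dots> \<le> ereal (\<Phi> (u, s))"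
      using min[of "(u, s)"] by (simp add: ext_epigraph_def s)
    finally show ?thesis by (simp add: \<Phi>_def s)
  qed
  then have "is_arg_min ?obj (\<lambda>_. True) p" by (simp add: is_arg_min_linorder)
  then have "is_arg_min ?obj (\<lambda>_. True) (prox \<eta> \<psi> x)"
    unfolding prox_def arg_min_def by (rule someI)
  then show ?thesis by (simp add: is_arg_min_linorder)
qed

lemma prox_in_dom:
  fixes \<psi> :: "'a::euclidean_space \<Rightarrow> ereal"
  assumes \<psi>: "proper_fun \<psi>" "closed_fun \<psi>" "convex_fun \<psi>" and \<eta>: "\<eta> > 0"
  shows "prox \<eta> \<psi> x \<in> ext_dom \<psi>"
proof (rule ccontr)
  assume "prox \<eta> \<psi> x \<notin> ext_dom \<psi>"
  then have *: "\<psi> (prox \<eta> \<psi> x) = \<infinity>" by (simp add: ext_dom_def)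
  obtain v where v: "v \<in> ext_dom \<psi>" using \<psi>(1) by (auto simp: proper_fun_def)
  from proper_fun_finite[OF \<psi>(1) v] obtain s where s: "\<psi> v = ereal s" by metis
  show False using prox_is_arg_min[OF assms, of x v] \<eta> by (simp add: * s)
qed

text \<open>First-order optimality without subdifferentials: the minimiser is compared with the
  points of the segment towards \<open>u\<close>.\<close>

lemma prox_variational:
  fixes \<psi> :: "'a::euclidean_space \<Rightarrow> ereal"
  assumes \<psi>: "proper_fun \<psi>" "closed_fun \<psi>" "convex_fun \<psi>" and \<eta>: "\<eta> > 0"
    and u: "u \<in> ext_dom \<psi>"
  shows "(x - prox \<eta> \<psi> x) \<bullet> (u - prox \<eta> \<psi> x)
      \<le> \<eta> * (real_of_ereal (\<psi> u) - real_of_ereal (\<psi> (prox \<eta> \<psi> x)))"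
proof -
  define p where "p = prox \<eta> \<psi> x"
  let ?\<psi> = "\<lambda>u. real_of_ereal (\<psi> u)"
  have p: "p \<in> ext_dom \<psi>" unfolding p_def by (rule prox_in_dom[OF \<psi> \<eta>])
  note conv = convex_fun_imp_convex_on[OF \<psi>(1,3)]
  define A where "A = \<eta> * (?\<psi> u - ?\<psi> p) + (p - x) \<bullet> (u - p)"
  \<comment> \<open>By convexity, moving from \<open>p\<close> to \<open>w\<close> changes the
    objective by at most \<open>s\<close> times the displayed sum. Dividing by \<open>s\<close> and
    letting it tend to 0 leaves \<open>A\<close>.\<close>
  have *: "0 \<le> A + s * ((norm (u - p))\<^sup>2 / 2)" if s: "0 < s" "s < 1" for s
  proof -
    define w where "w = (1 - s) *\<^sub>R p + s *\<^sub>R u"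
    have w: "w \<in> ext_dom \<psi>"
      using convexD_alt[OF _ p u, of s] conv s by (auto simp: w_def convex_on_def)
    have "ereal (\<eta> * ?\<psi> p + (norm (p - x))\<^sup>2 / 2) \<le> ereal (\<eta> * ?\<psi> w + (norm (w - x))\<^sup>2 / 2)"
    proof -
      obtain r r' where "\<psi> p = ereal r" "\<psi> w = ereal r'"
        using proper_fun_finite[OF \<psi>(1) p] proper_fun_finite[OF \<psi>(1) w] by metis
      then show ?thesis using prox_is_arg_min[OF \<psi> \<eta>, of x w] by (simp add: p_def)
    qed
    then have 1: "\<eta> * ?\<psi> p + (norm (p - x))\<^sup>2 / 2 \<le> \<eta> * ?\<psi> w + (norm (w - x))\<^sup>2 / 2" by simp
    have "?\<psi> w \<le> (1 - s) * ?\<psi> p + s * ?\<psi> u"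
      using convex_onD[OF conv, of s p u] s p u by (simp add: w_def)
    then have 2: "\<eta> * ?\<psi> w \<le> \<eta> * ((1 - s) * ?\<psi> p + s * ?\<psi> u)" using \<eta> by simp
    have "w - x = (p - x) + s *\<^sub>R (u - p)" by (simp add: w_def algebra_simps)
    then have "(norm (w - x))\<^sup>2
        = (norm (p - x))\<^sup>2 + 2 * s * ((p - x) \<bullet> (u - p)) + s\<^sup>2 * (norm (u - p))\<^sup>2"
      by (simp only: power2_norm_eq_inner)
         (simp add: inner_add_left inner_add_right inner_commute algebra_simps power2_eq_square)
    with 1 2 have "0 \<le> s * (A + s * ((norm (u - p))\<^sup>2 / 2))"
      by (simp add: A_def algebra_simps power2_eq_square)
    then show ?thesis using s by (simp add: zero_le_mult_iff)
  qed
  have "0 \<le> A"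
  proof (rule tendsto_lowerbound)
    show "((\<lambda>s. A + s * ((norm (u - p))\<^sup>2 / 2)) \<longlongrightarrow> A) (at_right 0)"
      by (auto intro!: tendsto_eq_intros)
    show "\<forall>\<^sub>F s in at_right 0. 0 \<le> A + s * ((norm (u - p))\<^sup>2 / 2)"
      using eventually_at_right_real[of 0 1] by (rule eventually_mono) (use * in auto)
  qed auto
  then show ?thesis
    by (simp add: A_def p_def inner_diff_left inner_diff_right algebra_simps)
qed

text \<open>Adding the variational inequalities of the two points cancels \<open>\<psi>\<close>. The
  result serves twice: it compares exact with estimated gradient steps, and it gives the continuity
  that makes \<open>prox\<close> measurable.\<close>

lemma prox_nonexpansive:
  fixes \<psi> :: "'a::euclidean_space \<Rightarrow> ereal"
  assumes \<psi>: "proper_fun \<psi>" "closed_fun \<psi>" "convex_fun \<psi>" and \<eta>: "\<eta> > 0"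
  shows "norm (prox \<eta> \<psi> x - prox \<eta> \<psi> y) \<le> norm (x - y)"
proof -
  let ?p = "prox \<eta> \<psi> x" and ?q = "prox \<eta> \<psi> y"
  note dom = prox_in_dom[OF \<psi> \<eta>]
  have "(x - ?p) \<bullet> (?q - ?p) + (y - ?q) \<bullet> (?p - ?q) \<le> 0"
    using prox_variational[OF \<psi> \<eta> dom, of x y] prox_variational[OF \<psi> \<eta> dom, of y x]
    by (simp add: algebra_simps)
  then have "(norm (?p - ?q))\<^sup>2 \<le> (x - y) \<bullet> (?p - ?q)"
    unfolding power2_norm_eq_inner
    by (simp add: inner_diff_left inner_diff_right inner_commute algebra_simps)
  also have "\<dots> \<le> norm (x - y) * norm (?p - ?q)" by (rule norm_cauchy_schwarz)
  finally show ?thesis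
    by (cases "?p = ?q") (simp_all add: power2_eq_square)
qed

lemma continuous_on_prox:
  fixes \<psi> :: "'a::euclidean_space \<Rightarrow> ereal"
  assumes "proper_fun \<psi>" "closed_fun \<psi>" "convex_fun \<psi>" and "\<eta> > 0"
  shows "continuous_on A (prox \<eta> \<psi>)"
  unfolding continuous_on_iff dist_norm
  using le_less_trans[OF prox_nonexpansive[OF assms]] by blast

section \<open>Second moments along independent samples\<close>

text \<open>The point at which a stochastic gradient is taken is itself random, so measurability in
  the sample for each fixed point does not suffice.\<close>

lemma borel_measurable_caratheodory:
  fixes g :: "'s \<Rightarrow> 'a::{metric_space, second_countable_topology} \<Rightarrow> 'b::metric_space"
  assumes meas: "\<And>y. (\<lambda>\<xi>. g \<xi> y) \<in> borel_measurable P"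
    and cont: "\<And>\<xi>. \<xi> \<in> space P \<Longrightarrow> continuous_on UNIV (g \<xi>)"
  shows "(\<lambda>z. g (snd z) (fst z)) \<in> borel_measurable (borel \<Otimes>\<^sub>M P)"
proof -
  \<comment> \<open>The identity is approximated by simple functions. With finitely many points
    inserted, measurability is immediate; continuity in the point carries it to the limit.\<close>
  from borel_measurable_implies_sequence_metric[of "\<lambda>y::'a. y" borel undefined]
  obtain s where s: "\<And>i. simple_function borel (s i)" "\<And>y::'a. (\<lambda>i. s i y) \<longlonglongrightarrow> y"
    by auto
  show ?thesis
  proof (rule borel_measurable_LIMSEQ_metric)
    show "(\<lambda>z. g (snd z) (s i (fst z))) \<in> borel_measurable (borel \<Otimes>\<^sub>M P)" for i
    proof (rule measurable_compose_countable'[where f = "\<lambda>y z. g (snd z) y" and I = "range (s i)"])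
      show "(\<lambda>z. g (snd z) y) \<in> borel_measurable (borel \<Otimes>\<^sub>M P)" for y
        by (rule measurable_compose[OF measurable_snd meas])
      have "s i \<in> measurable borel (count_space (range (s i)))"
        using s(1)[of i] by (auto simp: measurable_count_space_eq2 simple_function_def)
      then show "(\<lambda>z. s i (fst z)) \<in> measurable (borel \<Otimes>\<^sub>M P) (count_space (range (s i)))"
        by (rule measurable_compose[OF measurable_fst])
      show "countable (range (s i))"
        using s(1)[of i] by (simp add: simple_function_def countable_finite)
    qed
    fix z assume "z \<in> space ((borel :: 'a measure) \<Otimes>\<^sub>M P)"
    then have "snd z \<in> space P" by (auto simp: space_pair_measure)
    then show "(\<lambda>i. g (snd z) (s i (fst z))) \<longlonglongrightarrow> g (snd z) (fst z)"
      using continuous_on_tendsto_compose[OF cont s(2)] by simp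
  qed
qed

lemma (in prob_space) norm_add_centered:
  fixes X :: "'a \<Rightarrow> 'b::euclidean_space"
  assumes X: "integrable M X" "expectation X = 0" "integrable M (\<lambda>\<omega>. (norm (X \<omega>))\<^sup>2)"
  shows "integrable M (\<lambda>\<omega>. (norm (u + X \<omega>))\<^sup>2)"
    and "expectation (\<lambda>\<omega>. (norm (u + X \<omega>))\<^sup>2) = (norm u)\<^sup>2 + expectation (\<lambda>\<omega>. (norm (X \<omega>))\<^sup>2)"
proof -
  have *: "(norm (u + X \<omega>))\<^sup>2 = (norm u)\<^sup>2 + 2 * (u \<bullet> X \<omega>) + (norm (X \<omega>))\<^sup>2" for \<omega>
    unfolding power2_norm_eq_inner by (simp add: inner_add_left inner_add_right inner_commute)
  have "expectation (\<lambda>\<omega>. u \<bullet> X \<omega>) = 0" using X(1,2) by simp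
  with X show "integrable M (\<lambda>\<omega>. (norm (u + X \<omega>))\<^sup>2)"
    "expectation (\<lambda>\<omega>. (norm (u + X \<omega>))\<^sup>2) = (norm u)\<^sup>2 + expectation (\<lambda>\<omega>. (norm (X \<omega>))\<^sup>2)"
    unfolding * by (simp_all add: prob_space)
qed

text \<open>Used in two directions: nonnegativity of the left side is a Jensen inequality for the
  mean, and dropping the subtracted square bounds the centred moment by the raw one.\<close>

lemma (in prob_space) variance_vector:
  fixes X :: "'a \<Rightarrow> 'b::euclidean_space"
  assumes X: "integrable M X" "integrable M (\<lambda>\<omega>. (norm (X \<omega>))\<^sup>2)"
  shows "integrable M (\<lambda>\<omega>. (norm (X \<omega> - expectation X))\<^sup>2)"
    and "expectation (\<lambda>\<omega>. (norm (X \<omega> - expectation X))\<^sup>2)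
      = expectation (\<lambda>\<omega>. (norm (X \<omega>))\<^sup>2) - (norm (expectation X))\<^sup>2"
proof -
  have *: "(norm (X \<omega> - expectation X))\<^sup>2
      = (norm (X \<omega>))\<^sup>2 - 2 * (expectation X \<bullet> X \<omega>) + (norm (expectation X))\<^sup>2" for \<omega>
    unfolding power2_norm_eq_inner by (simp add: inner_diff_left inner_diff_right inner_commute)
  from X show "integrable M (\<lambda>\<omega>. (norm (X \<omega> - expectation X))\<^sup>2)"
    "expectation (\<lambda>\<omega>. (norm (X \<omega> - expectation X))\<^sup>2)
      = expectation (\<lambda>\<omega>. (norm (X \<omega>))\<^sup>2) - (norm (expectation X))\<^sup>2"
    unfolding * by (simp_all add: prob_space power2_norm_eq_inner)
qed

text \<open>Independence of the blocks \<open>J\<close> and \<open>{k}\<close> yields a function on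
  a singleton as second component; pushing forward along evaluation at \<open>k\<close> recovers the
  sample itself.\<close>

lemma (in prob_space) distr_past_and_sample:
  assumes ind: "indep_vars (\<lambda>_. P) S I" and J: "J \<subseteq> I" "k \<in> I" "k \<notin> J"
  shows "distr M (PiM J (\<lambda>_. P) \<Otimes>\<^sub>M P) (\<lambda>\<omega>. (\<lambda>i\<in>J. S i \<omega>, S k \<omega>))
    = distr M (PiM J (\<lambda>_. P)) (\<lambda>\<omega>. \<lambda>i\<in>J. S i \<omega>) \<Otimes>\<^sub>M distr M P (S k)"
proof -
  let ?J = "PiM J (\<lambda>_. P)" and ?K = "PiM {k} (\<lambda>_. P)"
  let ?R = "\<lambda>\<omega>. \<lambda>i\<in>J. S i \<omega>" and ?T = "\<lambda>\<omega>. \<lambda>i\<in>{k}. S i \<omega>"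
  have "indep_var ?J ?R ?K ?T" using J by (intro indep_var_restrict[OF ind]) auto
  then have [measurable]: "?R \<in> measurable M ?J" "?T \<in> measurable M ?K"
    and eq: "distr M ?J ?R \<Otimes>\<^sub>M distr M ?K ?T = distr M (?J \<Otimes>\<^sub>M ?K) (\<lambda>\<omega>. (?R \<omega>, ?T \<omega>))"
    unfolding indep_var_distribution_eq by auto
  have [measurable]: "(\<lambda>s. s k) \<in> measurable ?K P"
    by (rule measurable_component_singleton) simp
  have Sk: "distr M P (S k) = distr (distr M ?K ?T) P (\<lambda>s. s k)"
    by (subst distr_distr) (auto simp: comp_def)
  have rv: "random_variable P (S k)" using ind J by (simp add: indep_vars_def)
  interpret SP: prob_space "distr (distr M ?K ?T) P (\<lambda>s. s k)"
    unfolding Sk[symmetric] using rv by (rule prob_space_distr)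
  have "distr M ?J ?R \<Otimes>\<^sub>M distr M P (S k)
      = distr (distr M ?J ?R) ?J (\<lambda>a. a) \<Otimes>\<^sub>M distr (distr M ?K ?T) P (\<lambda>s. s k)"
    unfolding Sk by (simp add: distr_id2)
  also have "\<dots> = distr (distr M ?J ?R \<Otimes>\<^sub>M distr M ?K ?T) (?J \<Otimes>\<^sub>M P) (\<lambda>(a, s). (a, s k))"
    by (rule pair_measure_distr) (auto intro: SP.sigma_finite_measure_axioms)
  also have "\<dots> = distr M (?J \<Otimes>\<^sub>M P) (\<lambda>\<omega>. (?R \<omega>, S k \<omega>))"
    unfolding eq by (subst distr_distr) (auto simp: comp_def)
  finally show ?thesis ..
qed

text \<open>This replaces conditioning on the past: \<open>h a\<close> is the increment once the
  past is frozen at \<open>a\<close>, and \<open>c a\<close> bounds its second moment. The cross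
  term vanishes in the inner integral of Fubini.\<close>

lemma (in prob_space) second_moment_add_sample:
  fixes u :: "('i \<Rightarrow> 's) \<Rightarrow> 'b::euclidean_space"
  assumes P: "prob_space P"
    and ind: "indep_vars (\<lambda>_. P) S I" and J: "J \<subseteq> I" "k \<in> I" "k \<notin> J"
    and Sk: "distr M P (S k) = P"
    and u[measurable]: "u \<in> borel_measurable (PiM J (\<lambda>_. P))"
    and c[measurable]: "c \<in> borel_measurable (PiM J (\<lambda>_. P))"
    and h[measurable]: "(\<lambda>z. h (fst z) (snd z)) \<in> borel_measurable (PiM J (\<lambda>_. P) \<Otimes>\<^sub>M P)"
    and hc: "\<And>a. a \<in> space (PiM J (\<lambda>_. P)) \<Longrightarrow> integrable P (h a) \<and> integral\<^sup>L P (h a) = 0 \<and>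
        integrable P (\<lambda>\<xi>. (norm (h a \<xi>))\<^sup>2) \<and> (\<integral>\<xi>. (norm (h a \<xi>))\<^sup>2 \<partial>P) \<le> c a"
    and u_int: "integrable M (\<lambda>\<omega>. (norm (u (\<lambda>i\<in>J. S i \<omega>)))\<^sup>2)"
    and c_int: "integrable M (\<lambda>\<omega>. c (\<lambda>i\<in>J. S i \<omega>))"
  shows "integrable M (\<lambda>\<omega>. (norm (u (\<lambda>i\<in>J. S i \<omega>) + h (\<lambda>i\<in>J. S i \<omega>) (S k \<omega>)))\<^sup>2)"
    and "expectation (\<lambda>\<omega>. (norm (u (\<lambda>i\<in>J. S i \<omega>) + h (\<lambda>i\<in>J. S i \<omega>) (S k \<omega>)))\<^sup>2)
      \<le> expectation (\<lambda>\<omega>. (norm (u (\<lambda>i\<in>J. S i \<omega>)))\<^sup>2) + expectation (\<lambda>\<omega>. c (\<lambda>i\<in>J. S i \<omega>))"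
proof -
  let ?J = "PiM J (\<lambda>_. P)" and ?R = "\<lambda>\<omega>. \<lambda>i\<in>J. S i \<omega>"
  let ?N = "distr M ?J ?R"
  interpret P: prob_space P by fact
  have rv: "random_variable P (S i)" if "i \<in> I" for i using ind that by (simp add: indep_vars_def)
  have R[measurable]: "?R \<in> measurable M ?J"
    using J(1) by (intro measurable_restrict rv) auto
  have [measurable]: "S k \<in> measurable M P" using J(2) by (rule rv)
  interpret N: prob_space ?N using R by (rule prob_space_distr)
  interpret NP: pair_sigma_finite ?N P ..
  have joint: "distr M (?J \<Otimes>\<^sub>M P) (\<lambda>\<omega>. (?R \<omega>, S k \<omega>)) = ?N \<Otimes>\<^sub>M P"
    using distr_past_and_sample[OF ind J] by (simp add: Sk)
  define q where "q = (\<lambda>z. (norm (u (fst z) + h (fst z) (snd z)))\<^sup>2)"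
  have q[measurable]: "q \<in> borel_measurable (?J \<Otimes>\<^sub>M P)" unfolding q_def by measurable
  then have q'[measurable]: "q \<in> borel_measurable (?N \<Otimes>\<^sub>M P)" by (simp cong: measurable_cong_sets)
  have inner: "integrable P (\<lambda>\<xi>. q (a, \<xi>))" "(\<integral>\<xi>. q (a, \<xi>) \<partial>P) \<le> (norm (u a))\<^sup>2 + c a"
    if "a \<in> space ?J" for a
    using P.norm_add_centered[of "h a" "u a"] hc[OF that] by (auto simp: q_def)
  have uc: "integrable ?N (\<lambda>a. (norm (u a))\<^sup>2 + c a)"
    using u_int c_int by (intro Bochner_Integration.integrable_add) (simp_all add: integrable_distr_eq)
  have q0: "0 \<le> q z" for z by (simp add: q_def)
  \<comment> \<open>Integrability on the product is part of the claim. The inner integral is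
    dominated by \<open>(norm (u a))\<^sup>2 + c a\<close>, and since \<open>q\<close> is
    nonnegative this is all that Fubini's criterion asks for.\<close>
  have q_inner: "integrable ?N (\<lambda>a. \<integral>\<xi>. q (a, \<xi>) \<partial>P)"
  proof (rule Bochner_Integration.integrable_bound[OF uc])
    show "(\<lambda>a. \<integral>\<xi>. q (a, \<xi>) \<partial>P) \<in> borel_measurable ?N" by measurable
    show "AE a in ?N. norm (\<integral>\<xi>. q (a, \<xi>) \<partial>P) \<le> norm ((norm (u a))\<^sup>2 + c a)"
    proof (rule AE_I2)
      fix a assume "a \<in> space ?N"
      then have "(\<integral>\<xi>. q (a, \<xi>) \<partial>P) \<le> (norm (u a))\<^sup>2 + c a" using inner(2)[of a] by simp
      moreover have "0 \<le> (\<integral>\<xi>. q (a, \<xi>) \<partial>P)" by (simp add: q0)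
      ultimately show "norm (\<integral>\<xi>. q (a, \<xi>) \<partial>P) \<le> norm ((norm (u a))\<^sup>2 + c a)" by simp
    qed
  qed
  have q_int: "integrable (?N \<Otimes>\<^sub>M P) q"
  proof (rule NP.Fubini_integrable[OF q'])
    show "integrable ?N (\<lambda>a. \<integral>\<xi>. norm (q (a, \<xi>)) \<partial>P)" using q_inner q0 by simp
    show "AE a in ?N. integrable P (\<lambda>\<xi>. q (a, \<xi>))" using inner(1) by (intro AE_I2) simp
  qed
  then have "integrable M (\<lambda>\<omega>. q (?R \<omega>, S k \<omega>))"
    unfolding joint[symmetric] by (subst (asm) integrable_distr_eq) auto
  then show "integrable M (\<lambda>\<omega>. (norm (u (?R \<omega>) + h (?R \<omega>) (S k \<omega>)))\<^sup>2)" by (simp add: q_def)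
  have "expectation (\<lambda>\<omega>. (norm (u (?R \<omega>) + h (?R \<omega>) (S k \<omega>)))\<^sup>2)
      = integral\<^sup>L (distr M (?J \<Otimes>\<^sub>M P) (\<lambda>\<omega>. (?R \<omega>, S k \<omega>))) q"
    by (subst integral_distr) (auto simp: q_def)
  also have "\<dots> = (\<integral>a. (\<integral>\<xi>. q (a, \<xi>) \<partial>P) \<partial>?N)"
    unfolding joint by (rule NP.integral_fst'[OF q_int, symmetric])
  also have "\<dots> \<le> (\<integral>a. (norm (u a))\<^sup>2 + c a \<partial>?N)"
    using inner(2) by (intro integral_mono q_inner uc) simp
  also have "\<dots> = expectation (\<lambda>\<omega>. (norm (u (?R \<omega>)))\<^sup>2 + c (?R \<omega>))"
    by (subst integral_distr) auto
  also have "\<dots> = expectation (\<lambda>\<omega>. (norm (u (?R \<omega>)))\<^sup>2) + expectation (\<lambda>\<omega>. c (?R \<omega>))"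
    using u_int c_int by simp
  finally show "expectation (\<lambda>\<omega>. (norm (u (?R \<omega>) + h (?R \<omega>) (S k \<omega>)))\<^sup>2)
      \<le> expectation (\<lambda>\<omega>. (norm (u (?R \<omega>)))\<^sup>2) + expectation (\<lambda>\<omega>. c (?R \<omega>))" .
qed

text \<open>Every increment of a batch reads the same past \<open>J\<close>, although more samples
  have been revealed each time one is added.\<close>

lemma (in prob_space) second_moment_add_batch:
  fixes u :: "('i \<Rightarrow> 's) \<Rightarrow> 'b::euclidean_space"
  assumes P: "prob_space P"
    and ind: "indep_vars (\<lambda>_. P) S I" and J: "J \<subseteq> I"
    and S: "\<And>i. i \<in> I \<Longrightarrow> distr M P (S i) = P"
    and u[measurable]: "u \<in> borel_measurable (PiM J (\<lambda>_. P))"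
    and c[measurable]: "c \<in> borel_measurable (PiM J (\<lambda>_. P))"
    and h[measurable]: "(\<lambda>z. h (fst z) (snd z)) \<in> borel_measurable (PiM J (\<lambda>_. P) \<Otimes>\<^sub>M P)"
    and hc: "\<And>a. a \<in> space (PiM J (\<lambda>_. P)) \<Longrightarrow> integrable P (h a) \<and> integral\<^sup>L P (h a) = 0 \<and>
        integrable P (\<lambda>\<xi>. (norm (h a \<xi>))\<^sup>2) \<and> (\<integral>\<xi>. (norm (h a \<xi>))\<^sup>2 \<partial>P) \<le> c a"
    and u_int: "integrable M (\<lambda>\<omega>. (norm (u (\<lambda>i\<in>J. S i \<omega>)))\<^sup>2)"
    and c_int: "integrable M (\<lambda>\<omega>. c (\<lambda>i\<in>J. S i \<omega>))"
    and \<kappa>: "inj_on \<kappa> {..<n}" "\<kappa> ` {..<n} \<subseteq> I - J"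
  shows "integrable M (\<lambda>\<omega>. (norm (u (\<lambda>i\<in>J. S i \<omega>) + (\<Sum>j<n. h (\<lambda>i\<in>J. S i \<omega>) (S (\<kappa> j) \<omega>))))\<^sup>2)
    \<and> expectation (\<lambda>\<omega>. (norm (u (\<lambda>i\<in>J. S i \<omega>) + (\<Sum>j<n. h (\<lambda>i\<in>J. S i \<omega>) (S (\<kappa> j) \<omega>))))\<^sup>2)
      \<le> expectation (\<lambda>\<omega>. (norm (u (\<lambda>i\<in>J. S i \<omega>)))\<^sup>2)
        + real n * expectation (\<lambda>\<omega>. c (\<lambda>i\<in>J. S i \<omega>))"
  using \<kappa>
proof (induction n)
  case 0
  then show ?case using u_int by (simp del: restrict_apply)
next
  case (Suc n)
  let ?R = "\<lambda>\<omega>. \<lambda>i\<in>J. S i \<omega>"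
  \<comment> \<open>Samples already added join the past and the partial sum becomes the new
    \<open>u\<close>; \<open>h\<close> and \<open>c\<close> keep reading only \<open>J\<close>,
    through \<open>restrict\<close>.\<close>
  define J' where "J' = J \<union> \<kappa> ` {..<n}"
  define u' where "u' a = u (restrict a J) + (\<Sum>j<n. h (restrict a J) (a (\<kappa> j)))" for a
  have "J \<subseteq> J'" by (simp add: J'_def)
  have "J' \<subseteq> I" "\<kappa> n \<in> I" "\<kappa> n \<notin> J'"
    using J Suc.prems by (auto simp: J'_def lessThan_Suc)
  have restr[measurable]: "(\<lambda>a. restrict a J) \<in> measurable (PiM J' (\<lambda>_. P)) (PiM J (\<lambda>_. P))"
    by (rule measurable_restrict_subset) fact
  have [measurable]: "(\<lambda>a. h (restrict a J) (a (\<kappa> j))) \<in> borel_measurable (PiM J' (\<lambda>_. P))"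
    if "j < n" for j
  proof -
    have [measurable]: "(\<lambda>a. a (\<kappa> j)) \<in> measurable (PiM J' (\<lambda>_. P)) P"
      using that by (intro measurable_component_singleton) (auto simp: J'_def)
    have "(\<lambda>a. (restrict a J, a (\<kappa> j))) \<in> measurable (PiM J' (\<lambda>_. P)) (PiM J (\<lambda>_. P) \<Otimes>\<^sub>M P)"
      by measurable
    from measurable_compose[OF this h] show ?thesis by simp
  qed
  have u': "u' \<in> borel_measurable (PiM J' (\<lambda>_. P))"
    unfolding u'_def by (intro borel_measurable_add borel_measurable_sum) (auto intro: measurable_compose[OF restr u])
  have R: "restrict (\<lambda>i\<in>J'. S i \<omega>) J = ?R \<omega>" for \<omega>
    using \<open>J \<subseteq> J'\<close> by (simp add: Int_absorb1)
  have u'_eq: "u' (\<lambda>i\<in>J'. S i \<omega>) = u (?R \<omega>) + (\<Sum>j<n. h (?R \<omega>) (S (\<kappa> j) \<omega>))" for \<omega>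
    unfolding u'_def R by (intro arg_cong2[where f = "(+)"] sum.cong) (auto simp: J'_def)
  have IH: "integrable M (\<lambda>\<omega>. (norm (u' (\<lambda>i\<in>J'. S i \<omega>)))\<^sup>2)"
    "expectation (\<lambda>\<omega>. (norm (u' (\<lambda>i\<in>J'. S i \<omega>)))\<^sup>2)
      \<le> expectation (\<lambda>\<omega>. (norm (u (?R \<omega>)))\<^sup>2) + real n * expectation (\<lambda>\<omega>. c (?R \<omega>))"
    unfolding u'_eq using Suc.IH Suc.prems by (auto simp: lessThan_Suc simp del: restrict_apply)
  have "(\<lambda>z. (restrict (fst z) J, snd z))
      \<in> measurable (PiM J' (\<lambda>_. P) \<Otimes>\<^sub>M P) (PiM J (\<lambda>_. P) \<Otimes>\<^sub>M P)"
    by measurable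
  from measurable_compose[OF this h]
  have h': "(\<lambda>z. h (restrict (fst z) J) (snd z)) \<in> borel_measurable (PiM J' (\<lambda>_. P) \<Otimes>\<^sub>M P)"
    by simp
  have c': "(\<lambda>a. c (restrict a J)) \<in> borel_measurable (PiM J' (\<lambda>_. P))" by measurable
  let ?R' = "\<lambda>\<omega>. \<lambda>i\<in>J'. S i \<omega>"
  note step = second_moment_add_sample[where h = "\<lambda>a. h (restrict a J)", OF P ind
      \<open>J' \<subseteq> I\<close> \<open>\<kappa> n \<in> I\<close> \<open>\<kappa> n \<notin> J'\<close> S[OF \<open>\<kappa> n \<in> I\<close>] u' c' h'
      hc[OF measurable_space[OF restr]] IH(1), unfolded R, OF _ c_int]
  have eq: "u (?R \<omega>) + (\<Sum>j<Suc n. h (?R \<omega>) (S (\<kappa> j) \<omega>))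
      = u' (?R' \<omega>) + h (?R \<omega>) (S (\<kappa> n) \<omega>)" for \<omega>
    unfolding u'_eq by (simp del: restrict_apply)
  have "real (Suc n) * expectation (\<lambda>\<omega>. c (?R \<omega>))
      = real n * expectation (\<lambda>\<omega>. c (?R \<omega>)) + expectation (\<lambda>\<omega>. c (?R \<omega>))"
    by (simp add: algebra_simps)
  then show ?case
    unfolding eq using step IH(2) by linarith
qed

section \<open>A uniformly random index independent of the samples\<close>

lemma indep_rvs_compose:
  assumes M: "prob_space M" and ind: "indep_rvs M A X B Y"
    and f: "f \<in> measurable A A'" and g: "g \<in> measurable B B'"
  shows "indep_rvs M A' (\<lambda>\<omega>. f (X \<omega>)) B' (\<lambda>\<omega>. g (Y \<omega>))"
proof -
  interpret prob_space M by fact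
  have X: "X \<in> measurable M A" and Y: "Y \<in> measurable M B" using ind by (auto simp: indep_rvs_def)
  \<comment> \<open>A preimage under the composite is a preimage under the inner map, so the
    generated sigma-algebras can only shrink.\<close>
  have sub: "{(\<lambda>\<omega>. h (Z \<omega>)) -` C' \<inter> space M | C'. C' \<in> sets N'} \<subseteq> {Z -` C \<inter> space M | C. C \<in> sets N}"
    if Z: "Z \<in> measurable M N" and h: "h \<in> measurable N N'" for Z :: "'a \<Rightarrow> 'x" and N h and N' :: "'y measure"
  proof safe
    fix C' assume "C' \<in> sets N'"
    then have "h -` C' \<inter> space N \<in> sets N" using h by (rule measurable_sets[rotated])
    moreover have "(\<lambda>\<omega>. h (Z \<omega>)) -` C' \<inter> space M = Z -` (h -` C' \<inter> space N) \<inter> space M"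
      using measurable_space[OF Z] by auto
    ultimately show "\<exists>C. (\<lambda>\<omega>. h (Z \<omega>)) -` C' \<inter> space M = Z -` C \<inter> space M \<and> C \<in> sets N" by blast
  qed
  show ?thesis
    unfolding indep_rvs_def indep_set_def
  proof (intro conjI)
    show "indep_sets (case_bool
        (sigma_sets (space M) {(\<lambda>\<omega>. f (X \<omega>)) -` C \<inter> space M |C. C \<in> sets A'})
        (sigma_sets (space M) {(\<lambda>\<omega>. g (Y \<omega>)) -` C \<inter> space M |C. C \<in> sets B'})) UNIV"
    proof (rule indep_sets_mono_sets)
      show "indep_sets (case_bool
          (sigma_sets (space M) {X -` C \<inter> space M |C. C \<in> sets A})
          (sigma_sets (space M) {Y -` C \<inter> space M |C. C \<in> sets B})) UNIV"
        using ind by (simp add: indep_rvs_def indep_set_def)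
    qed (auto split: bool.split intro!: sigma_sets_mono' sub[OF X f] sub[OF Y g] del: subsetI)
  qed (use X Y f g in \<open>auto intro: measurable_compose\<close>)
qed

text \<open>Splitting by the value of \<open>\<tau>\<close> leaves, for each fixed \<open>t\<close>,
  a product of two independent real variables, and the indicator has mean
  \<open>1 / (real m + 1)\<close>.\<close>

lemma (in prob_space) expectation_uniform_index:
  fixes q :: "nat \<Rightarrow> 'b \<Rightarrow> real"
  assumes ind: "indep_rvs M (count_space {0..m}) \<tau> N R"
    and unif: "distr M (count_space {0..m}) \<tau> = uniform_count_measure {0..m}"
    and q: "\<And>t. t \<le> m \<Longrightarrow> q t \<in> borel_measurable N"
    and int: "\<And>t. t \<le> m \<Longrightarrow> integrable M (\<lambda>\<omega>. q t (R \<omega>))"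
  shows "integrable M (\<lambda>\<omega>. q (\<tau> \<omega>) (R \<omega>))"
    and "expectation (\<lambda>\<omega>. q (\<tau> \<omega>) (R \<omega>)) = (\<Sum>t\<le>m. expectation (\<lambda>\<omega>. q t (R \<omega>))) / (real m + 1)"
proof -
  have \<tau>: "\<tau> \<in> measurable M (count_space {0..m})" using ind by (simp add: indep_rvs_def)
  define I where "I t \<omega> = (indicator {t} (\<tau> \<omega>) :: real)" for t \<omega>
  have I: "integrable M (I t)" "expectation (I t) = 1 / (real m + 1)" if "t \<le> m" for t
  proof -
    have ind_meas: "(indicator {t} :: nat \<Rightarrow> real) \<in> borel_measurable (count_space {0..m})" by simp
    then show "integrable M (I t)"
      unfolding I_def by (intro integrable_const_bound[where B = 1] measurable_compose[OF \<tau>]) auto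
    have "expectation (I t) = integral\<^sup>L (distr M (count_space {0..m}) \<tau>) (indicator {t})"
      unfolding I_def using integral_distr[OF \<tau> ind_meas] by simp
    also have "\<dots> = 1 / (real m + 1)"
      using that unfolding unif by (simp add: measure_uniform_count_measure)
    finally show "expectation (I t) = 1 / (real m + 1)" .
  qed
  have prod: "integrable M (\<lambda>\<omega>. I t \<omega> * q t (R \<omega>))"
    "expectation (\<lambda>\<omega>. I t \<omega> * q t (R \<omega>)) = expectation (\<lambda>\<omega>. q t (R \<omega>)) / (real m + 1)"
    if t: "t \<le> m" for t
  proof -
    have "indep_rvs M borel (I t) borel (\<lambda>\<omega>. q t (R \<omega>))"
      unfolding I_def by (rule indep_rvs_compose[OF prob_space_axioms ind _ q[OF t]]) simp
    then have "indep_var borel (I t) borel (\<lambda>\<omega>. q t (R \<omega>))"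
      unfolding indep_var_eq by (simp add: indep_rvs_def)
    note indep_var_integrable[OF this I(1)[OF t] int[OF t]]
      indep_var_lebesgue_integral[OF this I(1)[OF t] int[OF t]]
    then show "integrable M (\<lambda>\<omega>. I t \<omega> * q t (R \<omega>))"
      "expectation (\<lambda>\<omega>. I t \<omega> * q t (R \<omega>)) = expectation (\<lambda>\<omega>. q t (R \<omega>)) / (real m + 1)"
      by (simp_all add: I(2)[OF t])
  qed
  have split: "q (\<tau> \<omega>) (R \<omega>) = (\<Sum>t\<le>m. I t \<omega> * q t (R \<omega>))" if "\<omega> \<in> space M" for \<omega>
  proof -
    have "\<tau> \<omega> \<le> m" using measurable_space[OF \<tau> that] by simp
    moreover have "(\<Sum>t\<le>m. I t \<omega> * q t (R \<omega>)) = (\<Sum>t\<le>m. if t = \<tau> \<omega> then q t (R \<omega>) else 0)"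
      by (rule sum.cong) (auto simp: I_def)
    ultimately show ?thesis by simp
  qed
  have "integrable M (\<lambda>\<omega>. \<Sum>t\<le>m. I t \<omega> * q t (R \<omega>))"
    using prod(1) by (intro Bochner_Integration.integrable_sum) auto
  then show "integrable M (\<lambda>\<omega>. q (\<tau> \<omega>) (R \<omega>))"
    by (simp cong: Bochner_Integration.integrable_cong add: split)
  show "expectation (\<lambda>\<omega>. q (\<tau> \<omega>) (R \<omega>)) = (\<Sum>t\<le>m. expectation (\<lambda>\<omega>. q t (R \<omega>))) / (real m + 1)"
    using prod by (simp cong: Bochner_Integration.integral_cong add: split sum_divide_distrib)
qed

section \<open>Parameter arithmetic\<close>

text \<open>The second fact controls the step term of the error recursion, the third makes the noise
  of all later rounds cost no more than that of the initial batch, and the last two evaluate the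
  denominators of the averaged bound.\<close>

lemma hsgd_parameters:
  fixes L c\<^sub>0 \<beta> \<gamma> \<eta> :: real and b bh bt m :: nat
  assumes L: "0 < L"
    and sizes: "1 \<le> b" "1 \<le> bt" "1 \<le> bh" "bh \<le> bt * (m + 1)"
    and c\<^sub>0: "0 < c\<^sub>0" "c\<^sub>0 \<le> sqrt 13 / (3 * sqrt (real b))"
    and \<beta>_eq: "\<beta> = 1 - sqrt (real bh) / sqrt (real bt * (real m + 1))"
    and \<gamma>_eq: "\<gamma> = 3 * c\<^sub>0 * real bh powr (1/4) * sqrt (real b)
                   / (sqrt 13 * (real bt * (real m + 1)) powr (1/4))"
    and \<eta>_eq: "\<eta> = 2 / (L * (3 + \<gamma>))"
  shows "0 \<le> \<beta> \<and> \<beta> < 1 \<and> 0 < \<gamma> \<and> \<gamma> \<le> 1 \<and> 1 / (2 * L) \<le> \<eta> \<and> \<eta> \<le> 2 / (3 * L)"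
    and "\<gamma>\<^sup>2 \<le> real b * (1 - \<beta>)"
    and "real m * (1 - \<beta>)\<^sup>2 / real bh \<le> 1 / real bt"
    and "\<gamma> * (real m + 1)
      = 3 * c\<^sub>0 * real bh powr (1/4) * sqrt (real b) * (real m + 1) powr (3/4) / (sqrt 13 * real bt powr (1/4))"
    and "real bt * (1 - \<beta>) * (real m + 1) = sqrt (real bh * real bt * (real m + 1))"
proof -
  define T where "T = real bt * (real m + 1)"
  have pos: "0 < real b" "0 < real bh" "0 < real bt" "0 < T" "0 < real m + 1"
    using sizes by (auto simp: T_def)
  have "real bh \<le> real (bt * (m + 1))" using sizes(4) by (simp only: of_nat_le_iff)
  then have bhT: "real bh \<le> T" by (simp add: T_def algebra_simps)
  define r where "r = sqrt (real bh) / sqrt T"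
  have \<beta>: "1 - \<beta> = r" by (simp add: \<beta>_eq r_def T_def)
  have r: "0 < r" "r \<le> 1" "r\<^sup>2 = real bh / T"
    using pos bhT by (auto simp: r_def power_divide)
  \<comment> \<open>\<open>\<gamma>\<close> factors as \<open>\<kappa> * \<rho>\<close>: the upper
    bound on \<open>c\<^sub>0\<close> says exactly that \<open>\<kappa>\<close> is at most 1, and
    the square of \<open>\<rho>\<close> is \<open>1 - \<beta>\<close>.\<close>
  define \<kappa> where "\<kappa> = 3 * c\<^sub>0 * sqrt (real b) / sqrt 13"
  define \<rho> where "\<rho> = real bh powr (1/4) / T powr (1/4)"
  have "(y powr (1/4))\<^sup>2 = sqrt y" if "0 < y" for y :: real
    using that by (simp add: powr_half_sqrt[symmetric] powr_power)
  then have \<rho>2: "\<rho>\<^sup>2 = r" using pos by (simp add: \<rho>_def r_def power_divide)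
  have \<rho>: "0 < \<rho>" using pos by (simp add: \<rho>_def)
  have "\<rho>\<^sup>2 \<le> 1\<^sup>2" using \<rho>2 r by simp
  then have \<rho>1: "\<rho> \<le> 1" by (rule power2_le_imp_le) simp
  have \<kappa>: "0 < \<kappa>" "\<kappa> \<le> 1"
    using pos c\<^sub>0 by (auto simp: \<kappa>_def field_simps)
  have \<gamma>: "\<gamma> = \<kappa> * \<rho>" by (simp add: \<gamma>_eq \<kappa>_def \<rho>_def T_def)
  have \<gamma>01: "0 < \<gamma>" "\<gamma> \<le> 1"
    using \<kappa> \<rho> \<rho>1 mult_mono[of \<kappa> 1 \<rho> 1] by (simp_all add: \<gamma>)
  have "3 * L \<le> L * (3 + \<gamma>)" "L * (3 + \<gamma>) \<le> 4 * L" using L \<gamma>01 by (simp_all add: algebra_simps)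
  then have "2 / (4 * L) \<le> \<eta>" "\<eta> \<le> 2 / (3 * L)"
    unfolding \<eta>_eq using L \<gamma>01 by (intro divide_left_mono; simp)+
  then have "1 / (2 * L) \<le> \<eta>" "\<eta> \<le> 2 / (3 * L)" by simp_all
  with \<gamma>01 r \<beta> show "0 \<le> \<beta> \<and> \<beta> < 1 \<and> 0 < \<gamma> \<and> \<gamma> \<le> 1 \<and> 1 / (2 * L) \<le> \<eta> \<and> \<eta> \<le> 2 / (3 * L)"
    by linarith
  have "\<kappa>\<^sup>2 \<le> 1" using \<kappa> by (simp add: power_le_one)
  then have "\<kappa>\<^sup>2 * r \<le> real b * r" using sizes(1) r by (intro mult_right_mono) auto
  then show "\<gamma>\<^sup>2 \<le> real b * (1 - \<beta>)" by (simp add: \<gamma> \<beta> power_mult_distrib \<rho>2)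
  have "real m * r\<^sup>2 / real bh = real m / T" using pos by (simp add: r(3))
  also have "\<dots> \<le> 1 / real bt" using pos by (simp add: T_def field_simps)
  finally show "real m * (1 - \<beta>)\<^sup>2 / real bh \<le> 1 / real bt" by (simp add: \<beta>)
  have "(real m + 1) powr (3/4) * (real m + 1) powr (1/4) = real m + 1"
    using pos(5) by (simp add: powr_add[symmetric])
  then have "(real m + 1) / (real m + 1) powr (1/4) = (real m + 1) powr (3/4)"
    using pos(5) by (metis nonzero_mult_div_cancel_right powr_eq_0_iff less_irrefl)
  moreover have "\<gamma> * (real m + 1) = 3 * c\<^sub>0 * real bh powr (1/4) * sqrt (real b)
      * ((real m + 1) / (real m + 1) powr (1/4)) / (sqrt 13 * real bt powr (1/4))"
    using pos by (simp add: \<gamma>_eq powr_mult)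
  ultimately show "\<gamma> * (real m + 1)
      = 3 * c\<^sub>0 * real bh powr (1/4) * sqrt (real b) * (real m + 1) powr (3/4) / (sqrt 13 * real bt powr (1/4))"
    by simp
  have "real bt * (1 - \<beta>) * (real m + 1) = T * r" by (simp add: \<beta> T_def)
  also have "\<dots> = sqrt (real bh) * (T / sqrt T)" by (simp add: r_def)
  also have "\<dots> = sqrt (real bh) * sqrt T" using pos by (simp add: real_div_sqrt)
  finally show "real bt * (1 - \<beta>) * (real m + 1) = sqrt (real bh * real bt * (real m + 1))"
    by (simp add: T_def real_sqrt_mult)
qed

text \<open>The scaled quantity is the target value of \<open>b (m + 1)\<close>: its power 2/3
  governs the accuracy, its power 1/3 the size of the initial batch.\<close>

lemma powr_three_halves_scaled:
  fixes \<Delta> \<epsilon> :: real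
  assumes "0 \<le> \<Delta>" "0 < \<epsilon>"
  shows "(\<Delta> powr (3/2) / \<epsilon> ^ 3) powr (1/3) = sqrt \<Delta> / \<epsilon>"
    and "(\<Delta> powr (3/2) / \<epsilon> ^ 3) powr (2/3) = \<Delta> / \<epsilon>\<^sup>2"
proof -
  have *: "(\<epsilon> ^ 3) powr (1/3) = \<epsilon>" "(\<epsilon> ^ 3) powr (2/3) = \<epsilon>\<^sup>2"
  proof -
    have "\<epsilon> ^ 3 = \<epsilon> powr 3" using assms by simp
    then show "(\<epsilon> ^ 3) powr (1/3) = \<epsilon>" "(\<epsilon> ^ 3) powr (2/3) = \<epsilon>\<^sup>2"
      using assms by (simp_all only: powr_powr) simp_all
  qed
  show "(\<Delta> powr (3/2) / \<epsilon> ^ 3) powr (1/3) = sqrt \<Delta> / \<epsilon>"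
    "(\<Delta> powr (3/2) / \<epsilon> ^ 3) powr (2/3) = \<Delta> / \<epsilon>\<^sup>2"
    using assms * by (simp_all add: powr_divide powr_powr powr_half_sqrt)
qed

text \<open>Bookkeeping of exponents: \<open>bt powr (1/4)\<close> contributes a factor
  \<open>(b (m + 1))\<close> to the power 1/12, and 1/4 + 1/2 = 2/3 + 1/12 as well as 3/4 = 2/3 +
  1/12, so both terms end up with the common power 2/3.\<close>

lemma mini_batch_bounds:
  fixes c\<^sub>0 c\<^sub>1 L D \<sigma> \<gamma> :: real and b bt m :: nat
  assumes pos: "1 \<le> b" "0 < c\<^sub>0" "0 < c\<^sub>1"
    and bt: "real bt = c\<^sub>1\<^sup>2 * (real b * (real m + 1)) powr (1/3)"
  shows "3 * c\<^sub>0 * real b powr (1/4) * sqrt (real b) / (sqrt 13 * (real bt * (real m + 1)) powr (1/4))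
      = 3 * c\<^sub>0 * real b powr (2/3) / (sqrt (13 * c\<^sub>1) * (real m + 1) powr (1/3))"
    and "16 * sqrt 13 * L * real bt powr (1/4) * D
            / (3 * c\<^sub>0 * real b powr (1/4) * sqrt (real b) * (real m + 1) powr (3/4))
          + 208 * \<sigma>\<^sup>2 / (9 * sqrt (real b * real bt * (real m + 1)))
      = 16 / 3 * (sqrt (13 * c\<^sub>1) * L * D / c\<^sub>0 + 13 * \<sigma>\<^sup>2 / (3 * c\<^sub>1))
          / (real b * (real m + 1)) powr (2/3)"
proof -
  define B n where "B = real b" and "n = real m + 1"
  have Bn: "0 < B" "0 < n" using pos by (simp_all add: B_def n_def)
  have bt': "real bt = c\<^sub>1\<^sup>2 * (B powr (1/3) * n powr (1/3))"
    using Bn by (simp add: bt B_def n_def powr_mult)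
  have c1: "(c\<^sub>1\<^sup>2) powr (1/4) = sqrt c\<^sub>1"
  proof -
    have "c\<^sub>1\<^sup>2 = c\<^sub>1 powr 2" using pos(3) by simp
    then show ?thesis using pos(3) by (simp only: powr_powr) (simp add: powr_half_sqrt)
  qed
  have bt4: "real bt powr (1/4) = sqrt c\<^sub>1 * (B powr (1/12) * n powr (1/12))"
    unfolding bt' using Bn pos(3) by (simp add: powr_mult powr_powr c1)
  have sB: "sqrt B = B powr (1/2)" "sqrt n = n powr (1/2)" using Bn by (simp_all add: powr_half_sqrt)
  have "(real bt * n) powr (1/4) = sqrt c\<^sub>1 * B powr (1/12) * (n powr (1/12) * n powr (1/4))"
    using Bn by (simp add: powr_mult bt4)
  also have "n powr (1/12) * n powr (1/4) = n powr (1/3)" by (simp add: powr_add[symmetric])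
  finally have d1: "(real bt * n) powr (1/4) = sqrt c\<^sub>1 * B powr (1/12) * n powr (1/3)" .
  have B34: "B powr (1/4) * sqrt B = B powr (2/3) * B powr (1/12)"
    unfolding sB by (simp add: powr_add[symmetric])
  have "3 * c\<^sub>0 * B powr (1/4) * sqrt B / (sqrt 13 * (real bt * n) powr (1/4))
      = 3 * c\<^sub>0 * (B powr (1/4) * sqrt B) / (sqrt 13 * (real bt * n) powr (1/4))" by simp
  also have "\<dots> = 3 * c\<^sub>0 * B powr (2/3) / (sqrt (13 * c\<^sub>1) * n powr (1/3))"
    unfolding B34 d1 using Bn by (simp add: real_sqrt_mult)
  finally show "3 * c\<^sub>0 * real b powr (1/4) * sqrt (real b) / (sqrt 13 * (real bt * (real m + 1)) powr (1/4))
      = 3 * c\<^sub>0 * real b powr (2/3) / (sqrt (13 * c\<^sub>1) * (real m + 1) powr (1/3))"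
    by (simp add: B_def n_def)
  have n34: "n powr (3/4) = n powr (2/3) * n powr (1/12)" by (simp add: powr_add[symmetric])
  have "16 * sqrt 13 * L * real bt powr (1/4) * D / (3 * c\<^sub>0 * B powr (1/4) * sqrt B * n powr (3/4))
      = 16 * sqrt 13 * L * real bt powr (1/4) * D / (3 * c\<^sub>0 * (B powr (1/4) * sqrt B) * n powr (3/4))"
    by simp
  also have "\<dots> = 16 / 3 * (sqrt (13 * c\<^sub>1) * L * D / c\<^sub>0) / (B powr (2/3) * n powr (2/3))"
    unfolding B34 n34 bt4 using Bn by (simp add: real_sqrt_mult ac_simps)
  finally have t1: "16 * sqrt 13 * L * real bt powr (1/4) * D / (3 * c\<^sub>0 * B powr (1/4) * sqrt B * n powr (3/4))
      = 16 / 3 * (sqrt (13 * c\<^sub>1) * L * D / c\<^sub>0) / (B powr (2/3) * n powr (2/3))" .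
  \<comment> \<open>Inserting \<open>bt\<close> raises both factors to the power 4/3, so the
    radicand is a perfect square.\<close>
  have "B * real bt * n = (c\<^sub>1 * (B powr (2/3) * n powr (2/3)))\<^sup>2"
  proof -
    have sq: "B * B powr (1/3) = (B powr (2/3))\<^sup>2" "n * n powr (1/3) = (n powr (2/3))\<^sup>2"
      using Bn by (simp_all add: powr_power powr_mult_base)
    show ?thesis unfolding bt' power_mult_distrib sq[symmetric] by (simp add: ac_simps)
  qed
  then have "sqrt (B * real bt * n) = c\<^sub>1 * (B powr (2/3) * n powr (2/3))" using pos(3) by simp
  with t1 show "16 * sqrt 13 * L * real bt powr (1/4) * D
            / (3 * c\<^sub>0 * real b powr (1/4) * sqrt (real b) * (real m + 1) powr (3/4))
          + 208 * \<sigma>\<^sup>2 / (9 * sqrt (real b * real bt * (real m + 1)))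
      = 16 / 3 * (sqrt (13 * c\<^sub>1) * L * D / c\<^sub>0 + 13 * \<sigma>\<^sup>2 / (3 * c\<^sub>1))
          / (real b * (real m + 1)) powr (2/3)"
    unfolding B_def[symmetric] n_def[symmetric] using Bn
    by (simp add: powr_mult add_divide_distrib distrib_left)
qed

section \<open>The hybrid stochastic proximal gradient method\<close>

text \<open>\<open>\<beta>\<close> and \<open>\<gamma>\<close> are only confined to their ranges;
  their coupling with the batch sizes enters as a hypothesis of the summed bounds. The domain is
  that of \<open>\<psi>\<close>, because \<open>f\<close> is finite, and \<open>F_low\<close> is a
  real lower bound, which keeps extended reals out of the analysis.\<close>

locale prox_hsgd =
  fixes P :: "'s measure" and M :: "'w measure"
    and g :: "'s \<Rightarrow> 'a::euclidean_space \<Rightarrow> 'a" and f :: "'a \<Rightarrow> real" and G :: "'a \<Rightarrow> 'a"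
    and \<psi> :: "'a \<Rightarrow> ereal" and F_low L \<sigma> \<beta> \<gamma> \<eta> :: real
    and b bh bt m :: nat and x\<^sub>0 :: 'a and S :: "sample_index \<Rightarrow> 'w \<Rightarrow> 's"
  assumes P: "prob_space P" and M: "prob_space M"
    and g_cont: "\<And>\<xi>. \<xi> \<in> space P \<Longrightarrow> continuous_on UNIV (g \<xi>)"
    and g_int: "\<And>y. integrable P (\<lambda>\<xi>. g \<xi> y)"
    and g_mean: "\<And>y. (\<integral>\<xi>. g \<xi> y \<partial>P) = G y"
    and f_deriv: "\<And>y. GDERIV f y :> G y"
    and \<psi>: "proper_fun \<psi>" "closed_fun \<psi>" "convex_fun \<psi>"
    and F_low: "\<And>y. y \<in> ext_dom \<psi> \<Longrightarrow> F_low \<le> f y + real_of_ereal (\<psi> y)"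
    and L: "0 < L"
    and g_lip: "\<And>y z. y \<in> ext_dom \<psi> \<Longrightarrow> z \<in> ext_dom \<psi> \<Longrightarrow>
          integrable P (\<lambda>\<xi>. (norm (g \<xi> y - g \<xi> z))\<^sup>2) \<and>
          (\<integral>\<xi>. (norm (g \<xi> y - g \<xi> z))\<^sup>2 \<partial>P) \<le> L\<^sup>2 * (norm (y - z))\<^sup>2"
    and g_var: "\<And>y. y \<in> ext_dom \<psi> \<Longrightarrow>
          integrable P (\<lambda>\<xi>. (norm (g \<xi> y - G y))\<^sup>2) \<and>
          (\<integral>\<xi>. (norm (g \<xi> y - G y))\<^sup>2 \<partial>P) \<le> \<sigma>\<^sup>2"
    and sizes: "1 \<le> b" "1 \<le> bt" "1 \<le> bh"
    and \<beta>: "0 \<le> \<beta>" "\<beta> < 1" and \<gamma>: "0 < \<gamma>" "\<gamma> \<le> 1"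
    and \<eta>_eq: "\<eta> = 2 / (L * (3 + \<gamma>))"
    and S_indep: "prob_space.indep_vars M (\<lambda>_. P) S (sample_indices bt b bh m)"
    and S_distr: "\<And>i. i \<in> sample_indices bt b bh m \<Longrightarrow> distr M P (S i) = P"
    and x\<^sub>0: "x\<^sub>0 \<in> ext_dom \<psi>"
begin

sublocale P: prob_space P by (rule P)
sublocale M: prob_space M by (rule M)

text \<open>Iterates take an arbitrary realisation \<open>s\<close>, so that inequalities hold for
  every \<open>s\<close> and dependence on the past can be expressed by restricting
  \<open>s\<close>.\<close>

definition X :: "nat \<Rightarrow> (sample_index \<Rightarrow> 's) \<Rightarrow> 'a" where
  "X t s = hsgd_x g \<psi> x\<^sub>0 bt b bh (\<lambda>_. \<beta>) (\<lambda>_. \<gamma>) (\<lambda>_. \<eta>) s t"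

definition V :: "nat \<Rightarrow> (sample_index \<Rightarrow> 's) \<Rightarrow> 'a" where
  "V t s = hsgd_v g \<psi> x\<^sub>0 bt b bh (\<lambda>_. \<beta>) (\<lambda>_. \<gamma>) (\<lambda>_. \<eta>) s t"

definition Y :: "nat \<Rightarrow> (sample_index \<Rightarrow> 's) \<Rightarrow> 'a" where
  "Y t s = prox \<eta> \<psi> (X t s - \<eta> *\<^sub>R V t s)"

definition err :: "nat \<Rightarrow> (sample_index \<Rightarrow> 's) \<Rightarrow> real" where
  "err t s = (norm (V t s - G (X t s)))\<^sup>2"

definition step :: "nat \<Rightarrow> (sample_index \<Rightarrow> 's) \<Rightarrow> real" where
  "step t s = (norm (Y t s - X t s))\<^sup>2"

definition gmap :: "'a \<Rightarrow> 'a" where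
  "gmap y = (1 / \<eta>) *\<^sub>R (y - prox \<eta> \<psi> (y - \<eta> *\<^sub>R G y))"

abbreviation idx :: "nat \<Rightarrow> sample_index set" where
  "idx t \<equiv> sample_indices bt b bh t"

abbreviation past :: "sample_index set \<Rightarrow> 'w \<Rightarrow> sample_index \<Rightarrow> 's" where
  "past J \<omega> \<equiv> (\<lambda>i\<in>J. S i \<omega>)"

lemma X_0: "X 0 s = x\<^sub>0"
  by (simp add: X_def)

lemma X_Suc: "X (Suc t) s = (1 - \<gamma>) *\<^sub>R X t s + \<gamma> *\<^sub>R Y t s"
  by (simp add: X_def V_def Y_def)

lemma V_0: "V 0 s = (1 / real bt) *\<^sub>R (\<Sum>i<bt. g (s (Init i)) x\<^sub>0)"
  by (simp add: V_def)

lemma V_Suc: "V (Suc t) s = \<beta> *\<^sub>R V t s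
    + (\<beta> / real b) *\<^sub>R (\<Sum>i<b. g (s (Batch (Suc t) i)) (X (Suc t) s) - g (s (Batch (Suc t) i)) (X t s))
    + ((1 - \<beta>) / real bh) *\<^sub>R (\<Sum>i<bh. g (s (Batch_hat (Suc t) i)) (X (Suc t) s))"
  by (simp only: X_def V_def hsgd_v.simps)

lemma idx_0: "idx 0 = Init ` {..<bt}"
  by (auto simp: sample_indices_def)

lemma idx_Suc: "idx (Suc t) = idx t \<union> Batch (Suc t) ` {..<b} \<union> Batch_hat (Suc t) ` {..<bh}"
  by (auto simp: sample_indices_def le_Suc_eq)

lemma idx_mono: "t \<le> n \<Longrightarrow> idx t \<subseteq> idx n"
  by (auto simp: sample_indices_def)

lemma new_notin_idx: "Batch (Suc t) i \<notin> idx t" "Batch_hat (Suc t) i \<notin> idx t"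
  by (auto simp: sample_indices_def)

lemma \<eta>: "0 < \<eta>" and inverse_\<eta>: "1 / \<eta> = L * (3 + \<gamma>) / 2" and inverse_\<eta>_le: "1 / \<eta> \<le> 2 * L"
proof -
  show "0 < \<eta>" using L \<gamma> by (simp add: \<eta>_eq)
  show *: "1 / \<eta> = L * (3 + \<gamma>) / 2" using L \<gamma> by (simp add: \<eta>_eq field_simps)
  show "1 / \<eta> \<le> 2 * L" unfolding * using L \<gamma> by (simp add: field_simps)
qed

section \<open>Inequalities along a fixed realisation\<close>

lemma convex_dom: "convex (ext_dom \<psi>)"
  using convex_fun_imp_convex_on[OF \<psi>(1,3)] by (simp add: convex_on_def)

lemma Y_in_dom: "Y t s \<in> ext_dom \<psi>"
  unfolding Y_def by (rule prox_in_dom[OF \<psi> \<eta>])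

lemma X_in_dom: "X t s \<in> ext_dom \<psi>"
proof (induction t)
  case 0
  then show ?case using x\<^sub>0 by (simp add: X_0)
next
  case (Suc t)
  then show ?case unfolding X_Suc using convexD_alt[OF convex_dom Suc Y_in_dom] \<gamma> by simp
qed

text \<open>The mean-square Lipschitz condition passes to the mean because a variance is
  nonnegative.\<close>

lemma G_lipschitz:
  assumes "y \<in> ext_dom \<psi>" "z \<in> ext_dom \<psi>"
  shows "norm (G y - G z) \<le> L * norm (y - z)"
proof -
  have D: "integrable P (\<lambda>\<xi>. g \<xi> y - g \<xi> z)" "(\<integral>\<xi>. g \<xi> y - g \<xi> z \<partial>P) = G y - G z"
    using g_int g_mean by simp_all
  have "0 \<le> (\<integral>\<xi>. (norm (g \<xi> y - g \<xi> z - (G y - G z)))\<^sup>2 \<partial>P)" by simp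
  also have "\<dots> = (\<integral>\<xi>. (norm (g \<xi> y - g \<xi> z))\<^sup>2 \<partial>P) - (norm (G y - G z))\<^sup>2"
    using P.variance_vector(2)[OF D(1)] g_lip[OF assms] unfolding D(2) by blast
  finally have "(norm (G y - G z))\<^sup>2 \<le> (L * norm (y - z))\<^sup>2"
    using g_lip[OF assms] by (simp add: power_mult_distrib)
  then show ?thesis by (rule power2_le_imp_le) (use L in simp)
qed

lemma objective_decrease:
  "f (X (Suc t) s) + real_of_ereal (\<psi> (X (Suc t) s)) + \<gamma> * (L * step t s - err t s / (2 * L))
    \<le> f (X t s) + real_of_ereal (\<psi> (X t s))"
proof -
  let ?\<psi> = "\<lambda>y. real_of_ereal (\<psi> y)"
  define x y x' v where "x = X t s" and "y = Y t s" and "x' = X (Suc t) s" and "v = V t s"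
  note defs = x_def[symmetric] y_def[symmetric] x'_def[symmetric] v_def[symmetric]
  have x': "x' = (1 - \<gamma>) *\<^sub>R x + \<gamma> *\<^sub>R y" by (simp add: x_def y_def x'_def X_Suc)
  then have diff: "x' - x = \<gamma> *\<^sub>R (y - x)" by (simp add: algebra_simps)
  have dom: "x \<in> ext_dom \<psi>" "x' \<in> ext_dom \<psi>" "y \<in> ext_dom \<psi>"
    by (simp_all add: x_def x'_def y_def X_in_dom Y_in_dom)
  have "f x' \<le> f x + G x \<bullet> (x' - x) + L / 2 * (norm (x' - x))\<^sup>2"
    by (rule descent_lemma[OF convex_dom dom(1,2) f_deriv G_lipschitz])
  then have f: "f x' \<le> f x + \<gamma> * (G x \<bullet> (y - x)) + L * \<gamma>\<^sup>2 / 2 * (norm (y - x))\<^sup>2"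
    unfolding diff using \<gamma> by (simp add: power_mult_distrib)
  have \<psi>1: "?\<psi> x' \<le> (1 - \<gamma>) * ?\<psi> x + \<gamma> * ?\<psi> y"
    unfolding x' using convex_onD[OF convex_fun_imp_convex_on[OF \<psi>(1,3)]] \<gamma> dom by simp
  have "(x - \<eta> *\<^sub>R v - y) \<bullet> (x - y) \<le> \<eta> * (?\<psi> x - ?\<psi> y)"
    using prox_variational[OF \<psi> \<eta> dom(1), of "x - \<eta> *\<^sub>R v"] by (simp add: y_def Y_def defs)
  moreover have "(x - \<eta> *\<^sub>R v - y) \<bullet> (x - y) = (norm (y - x))\<^sup>2 + \<eta> * (v \<bullet> (y - x))"
    unfolding power2_norm_eq_inner
    by (simp add: inner_diff_left inner_diff_right inner_commute algebra_simps)
  ultimately have "(1 / \<eta>) * (norm (y - x))\<^sup>2 + v \<bullet> (y - x) \<le> ?\<psi> x - ?\<psi> y"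
    using \<eta> by (simp add: field_simps)
  then have \<psi>2: "\<gamma> * ((1 / \<eta>) * (norm (y - x))\<^sup>2 + v \<bullet> (y - x)) \<le> \<gamma> * (?\<psi> x - ?\<psi> y)"
    using \<gamma> by simp
  have "(G x - v) \<bullet> (y - x) \<le> norm (v - G x) * norm (y - x)"
    using norm_cauchy_schwarz[of "G x - v" "y - x"] by (simp add: norm_minus_commute)
  \<comment> \<open>Young's inequality with weight \<open>L\<close>, so that the price in the step
    is \<open>L / 2\<close>, which the step size can afford.\<close>
  also have "\<dots> \<le> (norm (v - G x))\<^sup>2 / (2 * L) + L / 2 * (norm (y - x))\<^sup>2"
  proof -
    have "0 \<le> (norm (v - G x) - L * norm (y - x))\<^sup>2 / (2 * L)" using L by simp
    also have "\<dots> = (norm (v - G x))\<^sup>2 / (2 * L) + L / 2 * (norm (y - x))\<^sup>2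
        - norm (v - G x) * norm (y - x)"
      using L by (simp add: field_simps power2_eq_square)
    finally show ?thesis by simp
  qed
  finally have "\<gamma> * ((G x - v) \<bullet> (y - x))
      \<le> \<gamma> * ((norm (v - G x))\<^sup>2 / (2 * L) + L / 2 * (norm (y - x))\<^sup>2)"
    using \<gamma> by simp
  then have i: "\<gamma> * (G x \<bullet> (y - x)) - \<gamma> * (v \<bullet> (y - x))
      \<le> \<gamma> * (norm (v - G x))\<^sup>2 / (2 * L) + L * \<gamma> * (norm (y - x))\<^sup>2 / 2"
    by (simp add: inner_diff_left algebra_simps)
  \<comment> \<open>This is where \<open>\<eta>\<close> comes from: \<open>\<gamma> / \<eta>\<close>
    equals \<open>3 / 2 * L * \<gamma> + L * \<gamma>\<^sup>2 / 2\<close>. The quadratic part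
    cancels the term of the descent lemma, \<open>L * \<gamma> / 2\<close> pays for Young's
    inequality, and \<open>L * \<gamma>\<close> is left.\<close>
  have "3 / 2 * (L * \<gamma> * (norm (y - x))\<^sup>2) + L * \<gamma>\<^sup>2 / 2 * (norm (y - x))\<^sup>2 + \<gamma> * (v \<bullet> (y - x))
      \<le> \<gamma> * ?\<psi> x - \<gamma> * ?\<psi> y"
    using \<psi>2 unfolding inverse_\<eta> by (simp add: field_simps power2_eq_square)
  moreover have "?\<psi> x' \<le> ?\<psi> x - \<gamma> * ?\<psi> x + \<gamma> * ?\<psi> y" using \<psi>1 by (simp add: algebra_simps)
  moreover have "\<gamma> * (L * (norm (y - x))\<^sup>2 - (norm (v - G x))\<^sup>2 / (2 * L))
      = L * \<gamma> * (norm (y - x))\<^sup>2 - \<gamma> * (norm (v - G x))\<^sup>2 / (2 * L)"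
    by (simp add: algebra_simps)
  ultimately show ?thesis
    using f i unfolding err_def step_def defs by linarith
qed

lemma sum_objective_decrease:
  "\<gamma> * (\<Sum>t<n. L * step t s - err t s / (2 * L)) \<le> f x\<^sub>0 + real_of_ereal (\<psi> x\<^sub>0) - F_low"
proof -
  let ?F = "\<lambda>t. f (X t s) + real_of_ereal (\<psi> (X t s))"
  have "\<gamma> * (\<Sum>t<n. L * step t s - err t s / (2 * L)) \<le> (\<Sum>t<n. ?F t - ?F (Suc t))"
    unfolding sum_distrib_left by (rule sum_mono) (use objective_decrease in \<open>simp add: le_diff_eq add.commute\<close>)
  also have "\<dots> = ?F 0 - ?F n" by (rule sum_lessThan_telescope')
  finally show ?thesis using F_low[OF X_in_dom, of n s] by (simp add: X_0)
qed

text \<open>The proximal points for the estimated and for the exact gradient differ by at most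
  \<open>\<eta>\<close> times the estimation error; dividing by \<open>\<eta>\<close> frees the
  error term of it, and \<open>1 / \<eta>\<close> is at most \<open>2 * L\<close> in the other. The
  square of the sum then costs a factor 2.\<close>

lemma norm_gmap_le: "(norm (gmap (X t s)))\<^sup>2 \<le> 8 * L\<^sup>2 * step t s + 2 * err t s"
proof -
  define x y v where "x = X t s" and "y = Y t s" and "v = V t s"
  let ?p = "prox \<eta> \<psi> (x - \<eta> *\<^sub>R G x)"
  have "norm (x - ?p) \<le> norm (y - x) + norm (y - ?p)"
    using norm_triangle_ineq4[of "y - ?p" "y - x"] by simp
  also have "norm (y - ?p) \<le> norm (\<eta> *\<^sub>R (v - G x))"
    using prox_nonexpansive[OF \<psi> \<eta>, of "x - \<eta> *\<^sub>R v" "x - \<eta> *\<^sub>R G x"]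
    by (simp add: y_def Y_def x_def v_def norm_minus_commute algebra_simps)
  finally have "norm (x - ?p) \<le> norm (y - x) + \<eta> * norm (v - G x)" using \<eta> by simp
  from mult_left_mono[OF this, of "1 / \<eta>"]
  have "norm (gmap x) \<le> (1 / \<eta>) * (norm (y - x) + \<eta> * norm (v - G x))"
    using \<eta> by (simp add: gmap_def)
  also have "\<dots> = (1 / \<eta>) * norm (y - x) + norm (v - G x)" using \<eta> by (simp add: field_simps)
  also have "\<dots> \<le> 2 * L * norm (y - x) + norm (v - G x)"
    using mult_right_mono[OF inverse_\<eta>_le, of "norm (y - x)"] by simp
  finally have "(norm (gmap x))\<^sup>2 \<le> (2 * L * norm (y - x) + norm (v - G x))\<^sup>2"
    by (intro power_mono) auto
  also have "\<dots> \<le> 8 * L\<^sup>2 * (norm (y - x))\<^sup>2 + 2 * (norm (v - G x))\<^sup>2"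
    using zero_le_power2[of "2 * L * norm (y - x) - norm (v - G x)"]
    by (simp add: power2_eq_square algebra_simps)
  finally show ?thesis by (simp add: step_def err_def x_def y_def v_def)
qed

section \<open>Dependence on the revealed samples, and measurability\<close>

lemma iterates_cong:
  assumes "\<And>i. i \<in> idx t \<Longrightarrow> s i = s' i"
  shows "X t s = X t s' \<and> V t s = V t s' \<and> X (Suc t) s = X (Suc t) s'"
  using assms
proof (induction t)
  case 0
  then have "V 0 s = V 0 s'" by (simp add: V_0 idx_0)
  then show ?case by (simp add: X_0 X_Suc Y_def)
next
  case (Suc t)
  \<comment> \<open>\<open>V (Suc t)\<close> takes gradients at \<open>X (Suc t)\<close>, so that
    point has to be part of the induction hypothesis although its index is one ahead.\<close>
  then have IH: "X t s = X t s'" "V t s = V t s'" "X (Suc t) s = X (Suc t) s'"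
    by (auto simp: idx_Suc)
  have "V (Suc t) s = V (Suc t) s'"
    unfolding V_Suc IH using Suc.prems
    by (intro arg_cong2[where f = "(+)"] arg_cong2[where f = scaleR] sum.cong refl)
       (auto simp: idx_Suc)
  then show ?case using IH by (simp add: X_Suc[of "Suc t"] Y_def)
qed

text \<open>\<open>past J\<close> is \<open>undefined\<close> outside \<open>J\<close>. Independence
  and product measures speak of \<open>past\<close>, the pathwise bounds of the full realisation;
  this links the two.\<close>

lemma iterates_past:
  assumes "idx t \<subseteq> J"
  shows "X t (past J \<omega>) = X t (\<lambda>i. S i \<omega>)" "V t (past J \<omega>) = V t (\<lambda>i. S i \<omega>)"
    "X (Suc t) (past J \<omega>) = X (Suc t) (\<lambda>i. S i \<omega>)"
proof -
  have "past J \<omega> i = S i \<omega>" if "i \<in> idx t" for i using assms that by auto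
  from iterates_cong[of t "past J \<omega>" "\<lambda>i. S i \<omega>", OF this]
  show "X t (past J \<omega>) = X t (\<lambda>i. S i \<omega>)" "V t (past J \<omega>) = V t (\<lambda>i. S i \<omega>)"
    "X (Suc t) (past J \<omega>) = X (Suc t) (\<lambda>i. S i \<omega>)" by blast+
qed

lemma err_step_past:
  assumes "idx t \<subseteq> J"
  shows "err t (past J \<omega>) = err t (\<lambda>i. S i \<omega>)" "step t (past J \<omega>) = step t (\<lambda>i. S i \<omega>)"
  by (simp_all only: err_def step_def Y_def iterates_past[OF assms])

lemma measurable_g:
  assumes "p \<in> borel_measurable N" "q \<in> measurable N P"
  shows "(\<lambda>z. g (q z) (p z)) \<in> borel_measurable N"
proof -
  have "(\<lambda>z. g (snd z) (fst z)) \<in> borel_measurable (borel \<Otimes>\<^sub>M P)"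
    by (rule borel_measurable_caratheodory) (auto intro: g_cont borel_measurable_integrable g_int)
  from measurable_compose[OF measurable_Pair[OF assms] this] show ?thesis by simp
qed

lemma measurable_G [measurable]: "G \<in> borel_measurable borel"
proof -
  have "(\<lambda>y. \<integral>\<xi>. g \<xi> y \<partial>P) \<in> borel_measurable borel"
    by (rule P.borel_measurable_lebesgue_integral)
       (unfold case_prod_beta, intro measurable_g measurable_fst measurable_snd)
  then show ?thesis by (simp add: g_mean)
qed

lemma measurable_prox [measurable]: "prox \<eta> \<psi> \<in> borel_measurable borel"
  by (rule borel_measurable_continuous_onI[OF continuous_on_prox[OF \<psi> \<eta>]])

text \<open>The last conjunct is what makes the batches of round \<open>Suc t\<close> fresh: both
  points at which they are evaluated are functions of the samples up to round
  \<open>t\<close>.\<close>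

lemma measurable_iterates:
  assumes "idx t \<subseteq> J"
  shows "X t \<in> borel_measurable (PiM J (\<lambda>_. P)) \<and> V t \<in> borel_measurable (PiM J (\<lambda>_. P))
    \<and> X (Suc t) \<in> borel_measurable (PiM J (\<lambda>_. P))"
proof -
  have XS: "X (Suc t) \<in> borel_measurable (PiM J (\<lambda>_. P))"
    if [measurable]: "X t \<in> borel_measurable (PiM J (\<lambda>_. P))" "V t \<in> borel_measurable (PiM J (\<lambda>_. P))"
    for t
    unfolding X_Suc[abs_def] Y_def by measurable
  have comp: "(\<lambda>s. s k) \<in> measurable (PiM J (\<lambda>_. P)) P" if "k \<in> J" for k
    using that by (rule measurable_component_singleton)
  show ?thesis
    using assms
  proof (induction t)
    case 0
    have "X 0 \<in> borel_measurable (PiM J (\<lambda>_. P))" unfolding X_0[abs_def] by simp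
    moreover have "V 0 \<in> borel_measurable (PiM J (\<lambda>_. P))" unfolding V_0[abs_def]
      using 0 by (intro borel_measurable_scaleR borel_measurable_sum measurable_g comp) (auto simp: idx_0)
    ultimately show ?case using XS by blast
  next
    case (Suc t)
    then have IH: "X t \<in> borel_measurable (PiM J (\<lambda>_. P))" "V t \<in> borel_measurable (PiM J (\<lambda>_. P))"
      "X (Suc t) \<in> borel_measurable (PiM J (\<lambda>_. P))"
      by (auto simp: idx_Suc)
    then have "V (Suc t) \<in> borel_measurable (PiM J (\<lambda>_. P))" unfolding V_Suc[abs_def]
      using Suc.prems
      by (intro borel_measurable_add borel_measurable_diff borel_measurable_scaleR
          borel_measurable_sum measurable_g comp borel_measurable_const) (auto simp: idx_Suc)
    then show ?case using IH XS by blast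
  qed
qed

lemma measurable_past:
  assumes "J \<subseteq> idx m"
  shows "past J \<in> measurable M (PiM J (\<lambda>_. P))"
proof (rule measurable_restrict)
  show "S i \<in> measurable M P" if "i \<in> J" for i
    using S_indep assms that by (simp add: M.indep_vars_def subset_iff)
qed

lemma measurable_err_step:
  assumes "idx t \<subseteq> J"
  shows "err t \<in> borel_measurable (PiM J (\<lambda>_. P))" "step t \<in> borel_measurable (PiM J (\<lambda>_. P))"
    "(\<lambda>s. (norm (gmap (X t s)))\<^sup>2) \<in> borel_measurable (PiM J (\<lambda>_. P))"
proof -
  note [measurable] = measurable_iterates[OF assms, THEN conjunct1]
    measurable_iterates[OF assms, THEN conjunct2, THEN conjunct1]
  show "err t \<in> borel_measurable (PiM J (\<lambda>_. P))" "step t \<in> borel_measurable (PiM J (\<lambda>_. P))"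
    "(\<lambda>s. (norm (gmap (X t s)))\<^sup>2) \<in> borel_measurable (PiM J (\<lambda>_. P))"
    unfolding err_def[abs_def] step_def[abs_def] Y_def gmap_def by measurable
qed

lemma measurable_err_step_M:
  assumes "t \<le> m"
  shows "(\<lambda>\<omega>. err t (\<lambda>i. S i \<omega>)) \<in> borel_measurable M" "(\<lambda>\<omega>. step t (\<lambda>i. S i \<omega>)) \<in> borel_measurable M"
    "(\<lambda>\<omega>. (norm (gmap (X t (\<lambda>i. S i \<omega>))))\<^sup>2) \<in> borel_measurable M"
proof -
  have J: "idx t \<subseteq> idx m" using assms by (rule idx_mono)
  note comp = measurable_compose[OF measurable_past[OF subset_refl]]
  show "(\<lambda>\<omega>. err t (\<lambda>i. S i \<omega>)) \<in> borel_measurable M"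
    using comp[OF measurable_err_step(1)[OF J]] unfolding err_step_past[OF J] .
  show "(\<lambda>\<omega>. step t (\<lambda>i. S i \<omega>)) \<in> borel_measurable M"
    using comp[OF measurable_err_step(2)[OF J]] unfolding err_step_past[OF J] .
  show "(\<lambda>\<omega>. (norm (gmap (X t (\<lambda>i. S i \<omega>))))\<^sup>2) \<in> borel_measurable M"
    using comp[OF measurable_err_step(3)[OF J]] unfolding iterates_past[OF J] .
qed

section \<open>One-round recursion for the estimation error\<close>

abbreviation samples :: "'w \<Rightarrow> sample_index \<Rightarrow> 's" where
  "samples \<omega> \<equiv> (\<lambda>i. S i \<omega>)"

lemma centered_gradient:
  assumes "y \<in> ext_dom \<psi>"
  shows "integrable P (\<lambda>\<xi>. k *\<^sub>R (g \<xi> y - G y)) \<and> (\<integral>\<xi>. k *\<^sub>R (g \<xi> y - G y) \<partial>P) = 0 \<and>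
    integrable P (\<lambda>\<xi>. (norm (k *\<^sub>R (g \<xi> y - G y)))\<^sup>2) \<and>
    (\<integral>\<xi>. (norm (k *\<^sub>R (g \<xi> y - G y)))\<^sup>2 \<partial>P) \<le> k\<^sup>2 * \<sigma>\<^sup>2"
  using g_int[of y] g_mean[of y] g_var[OF assms]
  by (simp add: power_mult_distrib P.prob_space mult_left_mono)

text \<open>Centring only lowers the second moment, so the Lipschitz constant survives without an
  extra factor; \<open>k\<close> takes up the weight of one sample in its batch average.\<close>

lemma centered_gradient_difference:
  assumes "y \<in> ext_dom \<psi>" "z \<in> ext_dom \<psi>"
  defines "D \<equiv> \<lambda>\<xi>. g \<xi> y - g \<xi> z - (G y - G z)"
  shows "integrable P (\<lambda>\<xi>. k *\<^sub>R D \<xi>) \<and> (\<integral>\<xi>. k *\<^sub>R D \<xi> \<partial>P) = 0 \<and>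
    integrable P (\<lambda>\<xi>. (norm (k *\<^sub>R D \<xi>))\<^sup>2) \<and>
    (\<integral>\<xi>. (norm (k *\<^sub>R D \<xi>))\<^sup>2 \<partial>P) \<le> k\<^sup>2 * (L\<^sup>2 * (norm (y - z))\<^sup>2)"
proof -
  have int: "integrable P (\<lambda>\<xi>. g \<xi> y - g \<xi> z)" and mean: "(\<integral>\<xi>. g \<xi> y - g \<xi> z \<partial>P) = G y - G z"
    using g_int g_mean by simp_all
  note lip = g_lip[OF assms(1,2)]
  note var = P.variance_vector[OF int, unfolded mean, OF lip[THEN conjunct1]]
  have "(\<integral>\<xi>. (norm (D \<xi>))\<^sup>2 \<partial>P) \<le> L\<^sup>2 * (norm (y - z))\<^sup>2"
    using var(2) lip zero_le_power2[of "norm (G y - G z)"] unfolding D_def by linarith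
  moreover have "integrable P (\<lambda>\<xi>. (norm (D \<xi>))\<^sup>2)" using var(1) by (simp add: D_def)
  moreover have "integrable P D" "(\<integral>\<xi>. D \<xi> \<partial>P) = 0"
    unfolding D_def using int mean by (simp_all add: P.prob_space)
  ultimately show ?thesis by (simp add: power_mult_distrib mult_left_mono)
qed

lemma err_0:
  "integrable M (\<lambda>\<omega>. err 0 (samples \<omega>))"
  "M.expectation (\<lambda>\<omega>. err 0 (samples \<omega>)) \<le> \<sigma>\<^sup>2 / real bt"
proof -
  \<comment> \<open>The initial batch is the case of an empty past and \<open>u = 0\<close>: there
    are \<open>bt\<close> increments, each with second moment at most
    \<open>\<sigma>\<^sup>2 / bt\<^sup>2\<close>.\<close>
  let ?h = "\<lambda>_ \<xi>. (1 / real bt) *\<^sub>R (g \<xi> x\<^sub>0 - G x\<^sub>0)"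
  have "Init ` {..<bt} \<subseteq> idx m - {}" using idx_mono[of 0 m] by (simp add: idx_0)
  moreover have "(\<lambda>z. ?h (fst z) (snd z)) \<in> borel_measurable (PiM {} (\<lambda>_. P) \<Otimes>\<^sub>M P)"
    by (intro borel_measurable_scaleR borel_measurable_const borel_measurable_diff measurable_g measurable_snd)
  ultimately have *: "integrable M (\<lambda>\<omega>. (norm (0 + (\<Sum>j<bt. ?h (past {} \<omega>) (S (Init j) \<omega>))))\<^sup>2) \<and>
      M.expectation (\<lambda>\<omega>. (norm (0 + (\<Sum>j<bt. ?h (past {} \<omega>) (S (Init j) \<omega>))))\<^sup>2)
      \<le> M.expectation (\<lambda>\<omega>. (norm (0 :: 'a))\<^sup>2) + real bt * M.expectation (\<lambda>\<omega>. (1 / real bt)\<^sup>2 * \<sigma>\<^sup>2)"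
  proof (intro M.second_moment_add_batch[where u = "\<lambda>_. 0" and c = "\<lambda>_. (1 / real bt)\<^sup>2 * \<sigma>\<^sup>2",
        OF P S_indep _ S_distr] centered_gradient[OF x\<^sub>0])
  qed (auto simp: inj_on_def)
  have "(\<Sum>j<bt. (1 / real bt) *\<^sub>R (g (S (Init j) \<omega>) x\<^sub>0 - G x\<^sub>0)) = V 0 (samples \<omega>) - G (X 0 (samples \<omega>))" for \<omega>
    using sizes by (simp add: V_0 X_0 scaleR_sum_right[symmetric] sum_subtractf scaleR_diff_right
        sum_constant_scaleR)
  with * show "integrable M (\<lambda>\<omega>. err 0 (samples \<omega>))"
    "M.expectation (\<lambda>\<omega>. err 0 (samples \<omega>)) \<le> \<sigma>\<^sup>2 / real bt"
    using sizes by (simp_all add: err_def M.prob_space power2_eq_square)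
qed

text \<open>The two batches are added one after the other, the second treating the first as part of
  its past.\<close>

lemma err_Suc:
  assumes t: "Suc t \<le> m"
    and e: "integrable M (\<lambda>\<omega>. err t (samples \<omega>))"
    and d: "integrable M (\<lambda>\<omega>. step t (samples \<omega>))"
  shows "integrable M (\<lambda>\<omega>. err (Suc t) (samples \<omega>))" (is ?I)
    and "M.expectation (\<lambda>\<omega>. err (Suc t) (samples \<omega>))
      \<le> \<beta>\<^sup>2 * M.expectation (\<lambda>\<omega>. err t (samples \<omega>))
        + \<beta>\<^sup>2 * L\<^sup>2 * \<gamma>\<^sup>2 / real b * M.expectation (\<lambda>\<omega>. step t (samples \<omega>))
        + (1 - \<beta>)\<^sup>2 * \<sigma>\<^sup>2 / real bh" (is ?B)
proof -
  let ?J = "idx t" and ?J' = "idx t \<union> Batch (Suc t) ` {..<b}"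
  \<comment> \<open>\<open>u\<close> is the part of the old error that is kept, \<open>h\<close> and
    \<open>h'\<close> are the centred contributions of one sample of either batch. The bound
    \<open>c\<close> becomes a multiple of \<open>step t\<close> because \<open>X\<close> moves by
    \<open>\<gamma>\<close> times \<open>Y - X\<close>.\<close>
  define u where "u a = \<beta> *\<^sub>R (V t a - G (X t a))" for a
  define h where "h a \<xi> = (\<beta> / real b) *\<^sub>R
    (g \<xi> (X (Suc t) a) - g \<xi> (X t a) - (G (X (Suc t) a) - G (X t a)))" for a \<xi>
  define c where "c a = (\<beta> / real b)\<^sup>2 * (L\<^sup>2 * (norm (X (Suc t) a - X t a))\<^sup>2)" for a
  define u' where "u' a = u a + (\<Sum>j<b. h a (a (Batch (Suc t) j)))" for a
  define h' where "h' a \<xi> = ((1 - \<beta>) / real bh) *\<^sub>R (g \<xi> (X (Suc t) a) - G (X (Suc t) a))" for a \<xi>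
  have J: "idx t \<subseteq> ?J" "idx t \<subseteq> ?J'" by auto
  have sub: "?J \<subseteq> idx m" "?J' \<subseteq> idx m" "Batch (Suc t) ` {..<b} \<subseteq> idx m - ?J"
    "Batch_hat (Suc t) ` {..<bh} \<subseteq> idx m - ?J'"
    using idx_mono[OF t] new_notin_idx[of t] by (auto simp: idx_Suc)
  have meas: "X t \<in> borel_measurable (PiM K (\<lambda>_. P))" "V t \<in> borel_measurable (PiM K (\<lambda>_. P))"
    "X (Suc t) \<in> borel_measurable (PiM K (\<lambda>_. P))" if "idx t \<subseteq> K" for K
    using measurable_iterates[OF that] by blast+
  have u_meas: "u \<in> borel_measurable (PiM K (\<lambda>_. P))" and c_meas: "c \<in> borel_measurable (PiM K (\<lambda>_. P))"
    if "idx t \<subseteq> K" for K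
  proof -
    note [measurable] = meas[OF that]
    show "u \<in> borel_measurable (PiM K (\<lambda>_. P))" "c \<in> borel_measurable (PiM K (\<lambda>_. P))"
      unfolding u_def[abs_def] c_def[abs_def] by measurable
  qed
  have h_meas: "(\<lambda>z. h (p z) (q z)) \<in> borel_measurable N" "(\<lambda>z. h' (p z) (q z)) \<in> borel_measurable N"
    if K: "idx t \<subseteq> K" and p: "p \<in> measurable N (PiM K (\<lambda>_. P))" and q: "q \<in> measurable N P"
    for K N and p :: "'x \<Rightarrow> sample_index \<Rightarrow> 's" and q
    unfolding h_def h'_def
    by (intro borel_measurable_scaleR borel_measurable_const borel_measurable_diff measurable_g
        q measurable_compose[OF _ measurable_G] measurable_compose[OF p] meas[OF K])+
  have "(\<lambda>a. h a (a (Batch (Suc t) j))) \<in> borel_measurable (PiM ?J' (\<lambda>_. P))" if "j < b" for j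
    using that by (intro h_meas(1)[OF J(2)] measurable_ident measurable_component_singleton) auto
  then have u'_meas: "u' \<in> borel_measurable (PiM ?J' (\<lambda>_. P))"
    unfolding u'_def[abs_def] by (intro borel_measurable_add u_meas[OF J(2)] borel_measurable_sum) auto
  have u_past: "u (past ?J \<omega>) = \<beta> *\<^sub>R (V t (samples \<omega>) - G (X t (samples \<omega>)))"
    and c_past: "c (past ?J \<omega>) = \<beta>\<^sup>2 * L\<^sup>2 * \<gamma>\<^sup>2 / (real b)\<^sup>2 * step t (samples \<omega>)"
    and h_past: "h (past ?J \<omega>) = h (samples \<omega>)" "h (past ?J' \<omega>) = h (samples \<omega>)"
    and h'_past: "h' (past ?J' \<omega>) = h' (samples \<omega>)"
    and u_past2: "u (past ?J \<omega>) = u (samples \<omega>)" "u (past ?J' \<omega>) = u (samples \<omega>)" for \<omega>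
  proof -
    have "X (Suc t) (samples \<omega>) - X t (samples \<omega>) = \<gamma> *\<^sub>R (Y t (samples \<omega>) - X t (samples \<omega>))"
      unfolding X_Suc by (simp add: algebra_simps)
    then show "c (past ?J \<omega>) = \<beta>\<^sup>2 * L\<^sup>2 * \<gamma>\<^sup>2 / (real b)\<^sup>2 * step t (samples \<omega>)"
      unfolding c_def iterates_past[OF J(1)] step_def
      by (simp add: power_mult_distrib power_divide)
  qed (simp_all only: u_def h_def[abs_def] h'_def[abs_def] iterates_past[OF J(1)] iterates_past[OF J(2)])
  have u'_past: "u' (past ?J' \<omega>) = u (past ?J \<omega>) + (\<Sum>j<b. h (past ?J \<omega>) (S (Batch (Suc t) j) \<omega>))" for \<omega>
    unfolding u'_def h_past u_past2 by (intro arg_cong2[where f = "(+)"] sum.cong refl) auto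
  have 1: "integrable M (\<lambda>\<omega>. (norm (u (past ?J \<omega>) + (\<Sum>j<b. h (past ?J \<omega>) (S (Batch (Suc t) j) \<omega>))))\<^sup>2) \<and>
      M.expectation (\<lambda>\<omega>. (norm (u (past ?J \<omega>) + (\<Sum>j<b. h (past ?J \<omega>) (S (Batch (Suc t) j) \<omega>))))\<^sup>2)
      \<le> M.expectation (\<lambda>\<omega>. (norm (u (past ?J \<omega>)))\<^sup>2) + real b * M.expectation (\<lambda>\<omega>. c (past ?J \<omega>))"
  proof (rule M.second_moment_add_batch[OF P S_indep sub(1) S_distr u_meas[OF J(1)] c_meas[OF J(1)]])
    show "(\<lambda>z. h (fst z) (snd z)) \<in> borel_measurable (PiM ?J (\<lambda>_. P) \<Otimes>\<^sub>M P)"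
      by (rule h_meas(1)[OF J(1) measurable_fst measurable_snd])
    show "integrable P (h a) \<and> integral\<^sup>L P (h a) = 0 \<and> integrable P (\<lambda>\<xi>. (norm (h a \<xi>))\<^sup>2) \<and>
        (\<integral>\<xi>. (norm (h a \<xi>))\<^sup>2 \<partial>P) \<le> c a" for a
      unfolding h_def c_def by (rule centered_gradient_difference[OF X_in_dom X_in_dom])
    show "integrable M (\<lambda>\<omega>. (norm (u (past ?J \<omega>)))\<^sup>2)"
      using e unfolding u_past by (simp add: err_def power_mult_distrib)
    show "integrable M (\<lambda>\<omega>. c (past ?J \<omega>))" using d unfolding c_past by simp
  qed (use sub in \<open>auto simp: inj_on_def\<close>)
  have 2: "integrable M (\<lambda>\<omega>. (norm (u' (past ?J' \<omega>) + (\<Sum>j<bh. h' (past ?J' \<omega>) (S (Batch_hat (Suc t) j) \<omega>))))\<^sup>2) \<and>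
      M.expectation (\<lambda>\<omega>. (norm (u' (past ?J' \<omega>) + (\<Sum>j<bh. h' (past ?J' \<omega>) (S (Batch_hat (Suc t) j) \<omega>))))\<^sup>2)
      \<le> M.expectation (\<lambda>\<omega>. (norm (u' (past ?J' \<omega>)))\<^sup>2)
        + real bh * M.expectation (\<lambda>\<omega>. ((1 - \<beta>) / real bh)\<^sup>2 * \<sigma>\<^sup>2)"
  proof (rule M.second_moment_add_batch[OF P S_indep sub(2) S_distr u'_meas])
    show "(\<lambda>z. h' (fst z) (snd z)) \<in> borel_measurable (PiM ?J' (\<lambda>_. P) \<Otimes>\<^sub>M P)"
      by (rule h_meas(2)[OF J(2) measurable_fst measurable_snd])
    show "integrable P (h' a) \<and> integral\<^sup>L P (h' a) = 0 \<and> integrable P (\<lambda>\<xi>. (norm (h' a \<xi>))\<^sup>2) \<and>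
        (\<integral>\<xi>. (norm (h' a \<xi>))\<^sup>2 \<partial>P) \<le> ((1 - \<beta>) / real bh)\<^sup>2 * \<sigma>\<^sup>2" for a
      unfolding h'_def by (rule centered_gradient[OF X_in_dom])
    show "integrable M (\<lambda>\<omega>. (norm (u' (past ?J' \<omega>)))\<^sup>2)" unfolding u'_past using 1 by blast
  qed (use sub in \<open>auto simp: inj_on_def\<close>)
  \<comment> \<open>The mean terms carried by \<open>u\<close>, by the first batch and by the second
    batch add up to minus the exact gradient at the new point, so the sum is precisely the new error
    vector.\<close>
  have err: "(norm (u' (past ?J' \<omega>) + (\<Sum>j<bh. h' (past ?J' \<omega>) (S (Batch_hat (Suc t) j) \<omega>))))\<^sup>2
      = err (Suc t) (samples \<omega>)" for \<omega>
  proof -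
    let ?s = "samples \<omega>"
    let ?D = "G (X (Suc t) ?s) - G (X t ?s)"
    have hs: "(\<Sum>j<b. h ?s (S (Batch (Suc t) j) \<omega>))
        = (\<beta> / real b) *\<^sub>R (\<Sum>j<b. g (S (Batch (Suc t) j) \<omega>) (X (Suc t) ?s) - g (S (Batch (Suc t) j) \<omega>) (X t ?s))
          - \<beta> *\<^sub>R ?D"
      using sizes unfolding h_def scaleR_sum_right[symmetric] sum_subtractf[where g = "\<lambda>_. ?D"]
      by (simp add: sum_constant_scaleR scaleR_diff_right)
    have h's: "(\<Sum>j<bh. h' ?s (S (Batch_hat (Suc t) j) \<omega>))
        = ((1 - \<beta>) / real bh) *\<^sub>R (\<Sum>j<bh. g (S (Batch_hat (Suc t) j) \<omega>) (X (Suc t) ?s))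
          - (1 - \<beta>) *\<^sub>R G (X (Suc t) ?s)"
      using sizes unfolding h'_def scaleR_sum_right[symmetric] sum_subtractf
      by (simp add: sum_constant_scaleR scaleR_diff_right)
    have "u' (past ?J' \<omega>) + (\<Sum>j<bh. h' (past ?J' \<omega>) (S (Batch_hat (Suc t) j) \<omega>))
        = V (Suc t) ?s - G (X (Suc t) ?s)"
      unfolding u'_past h_past h'_past u_past hs h's V_Suc by (simp add: algebra_simps)
    then show ?thesis by (simp add: err_def)
  qed
  show ?I using 2 unfolding err by blast
  have eu: "M.expectation (\<lambda>\<omega>. (norm (u (past ?J \<omega>)))\<^sup>2) = \<beta>\<^sup>2 * M.expectation (\<lambda>\<omega>. err t (samples \<omega>))"
    unfolding u_past by (simp add: err_def power_mult_distrib)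
  have ec: "real b * M.expectation (\<lambda>\<omega>. c (past ?J \<omega>))
      = \<beta>\<^sup>2 * L\<^sup>2 * \<gamma>\<^sup>2 / real b * M.expectation (\<lambda>\<omega>. step t (samples \<omega>))"
    unfolding c_past using sizes by (simp add: power2_eq_square)
  have "real bh * M.expectation (\<lambda>\<omega>. ((1 - \<beta>) / real bh)\<^sup>2 * \<sigma>\<^sup>2) = (1 - \<beta>)\<^sup>2 * \<sigma>\<^sup>2 / real bh"
    using sizes by (simp add: M.prob_space power2_eq_square)
  moreover have "M.expectation (\<lambda>\<omega>. err (Suc t) (samples \<omega>))
      \<le> M.expectation (\<lambda>\<omega>. (norm (u' (past ?J' \<omega>)))\<^sup>2)
        + real bh * M.expectation (\<lambda>\<omega>. ((1 - \<beta>) / real bh)\<^sup>2 * \<sigma>\<^sup>2)"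
    using 2 unfolding err by blast
  ultimately show ?B using 1 unfolding u'_past eu ec by linarith
qed

section \<open>Integrability and summation over all rounds\<close>

lemma step_nonneg: "0 \<le> step t s"
  by (simp add: step_def)

text \<open>The lower bound on the objective dominates every single step, along each realisation, by
  the errors accumulated so far.\<close>

lemma step_integrable:
  assumes "t \<le> m" and e: "\<And>r. r \<le> t \<Longrightarrow> integrable M (\<lambda>\<omega>. err r (samples \<omega>))"
  shows "integrable M (\<lambda>\<omega>. step t (samples \<omega>))"
proof (rule Bochner_Integration.integrable_bound)
  let ?D = "f x\<^sub>0 + real_of_ereal (\<psi> x\<^sub>0) - F_low"
  let ?b = "\<lambda>\<omega>. (?D / \<gamma> + (\<Sum>r<Suc t. err r (samples \<omega>)) / (2 * L)) / L"
  show "integrable M ?b" using e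
    by (intro Bochner_Integration.integrable_divide Bochner_Integration.integrable_add
        Bochner_Integration.integrable_sum) auto
  show "(\<lambda>\<omega>. step t (samples \<omega>)) \<in> borel_measurable M" by (rule measurable_err_step_M) fact
  have "step t s \<le> (?D / \<gamma> + (\<Sum>r<Suc t. err r s) / (2 * L)) / L" for s
  proof -
    have "L * step t s \<le> (\<Sum>r<Suc t. L * step r s)"
      using L by (intro member_le_sum) (auto simp: step_def)
    moreover have "(\<Sum>r<Suc t. L * step r s - err r s / (2 * L)) \<le> ?D / \<gamma>"
      using sum_objective_decrease[of s "Suc t"] \<gamma> by (simp only: pos_le_divide_eq mult.commute)
    ultimately show ?thesis
      using L by (simp add: sum_subtractf sum_divide_distrib pos_le_divide_eq mult.commute del: sum.lessThan_Suc)
  qed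
  then have "norm (step t (samples \<omega>)) \<le> norm (?b \<omega>)" for \<omega>
    using abs_ge_self[of "?b \<omega>"] unfolding real_norm_def abs_of_nonneg[OF step_nonneg]
    by (rule order_trans)
  then show "AE \<omega> in M. norm (step t (samples \<omega>)) \<le> norm (?b \<omega>)" by simp
qed

lemma err_step_integrable:
  assumes "t \<le> m"
  shows "integrable M (\<lambda>\<omega>. err t (samples \<omega>))" "integrable M (\<lambda>\<omega>. step t (samples \<omega>))"
proof -
  \<comment> \<open>The whole initial segment is carried along, since the bound on
    \<open>step t\<close> involves every error up to \<open>t\<close>.\<close>
  have "\<forall>r\<le>t. integrable M (\<lambda>\<omega>. err r (samples \<omega>))"
    using assms
  proof (induction t)
    case 0
    then show ?case using err_0 by simp
  next
    case (Suc t)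
    then have IH: "\<forall>r\<le>t. integrable M (\<lambda>\<omega>. err r (samples \<omega>))" and t: "t \<le> m" by auto
    then have "integrable M (\<lambda>\<omega>. step t (samples \<omega>))" by (intro step_integrable) auto
    with IH have "integrable M (\<lambda>\<omega>. err (Suc t) (samples \<omega>))" by (intro err_Suc Suc.prems) auto
    with IH show ?case by (auto simp: le_Suc_eq)
  qed
  then show "integrable M (\<lambda>\<omega>. err t (samples \<omega>))" "integrable M (\<lambda>\<omega>. step t (samples \<omega>))"
    using assms by (auto intro: step_integrable)
qed

lemma gmap_integrable:
  assumes "t \<le> m"
  shows "integrable M (\<lambda>\<omega>. (norm (gmap (X t (samples \<omega>))))\<^sup>2)"
proof (rule Bochner_Integration.integrable_bound)
  show "integrable M (\<lambda>\<omega>. 8 * L\<^sup>2 * step t (samples \<omega>) + 2 * err t (samples \<omega>))"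
    using err_step_integrable[OF assms] by simp
  show "(\<lambda>\<omega>. (norm (gmap (X t (samples \<omega>))))\<^sup>2) \<in> borel_measurable M"
    by (rule measurable_err_step_M) fact
  show "AE \<omega> in M. norm ((norm (gmap (X t (samples \<omega>))))\<^sup>2)
      \<le> norm (8 * L\<^sup>2 * step t (samples \<omega>) + 2 * err t (samples \<omega>))"
    using norm_gmap_le by (intro AE_I2) (smt (verit) real_norm_def zero_le_power2)
qed

lemma sum_err_le:
  assumes tie1: "\<gamma>\<^sup>2 \<le> real b * (1 - \<beta>)" and tie2: "real m * (1 - \<beta>)\<^sup>2 / real bh \<le> 1 / real bt"
  shows "(\<Sum>t\<le>m. M.expectation (\<lambda>\<omega>. err t (samples \<omega>)))
    \<le> 2 * \<sigma>\<^sup>2 / (real bt * (1 - \<beta>)) + L\<^sup>2 / 2 * (\<Sum>t\<le>m. M.expectation (\<lambda>\<omega>. step t (samples \<omega>)))"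
proof -
  define e where "e t = M.expectation (\<lambda>\<omega>. err t (samples \<omega>))" for t
  define d where "d t = M.expectation (\<lambda>\<omega>. step t (samples \<omega>))" for t
  define \<Sigma>e \<Sigma>d where "\<Sigma>e = (\<Sum>t\<le>m. e t)" and "\<Sigma>d = (\<Sum>t\<le>m. d t)"
  have e0: "0 \<le> e t" and d0: "0 \<le> d t" for t
    by (simp_all add: e_def d_def err_def step_def)
  then have \<Sigma>0: "0 \<le> \<Sigma>e" "0 \<le> \<Sigma>d" by (simp_all add: \<Sigma>e_def \<Sigma>d_def sum_nonneg)
  have sub: "(\<Sum>t<m. e t) \<le> \<Sigma>e" "(\<Sum>t<m. d t) \<le> \<Sigma>d"
    unfolding \<Sigma>e_def \<Sigma>d_def using e0 d0 by (auto intro!: sum_mono2)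
  let ?K = "\<beta>\<^sup>2 * L\<^sup>2 * \<gamma>\<^sup>2 / real b"
  have "\<Sigma>e = e 0 + (\<Sum>t<m. e (Suc t))"
    unfolding \<Sigma>e_def lessThan_Suc_atMost[symmetric] by (rule sum.lessThan_Suc_shift)
  also have "\<dots> \<le> \<sigma>\<^sup>2 / real bt + (\<Sum>t<m. \<beta>\<^sup>2 * e t + ?K * d t + (1 - \<beta>)\<^sup>2 * \<sigma>\<^sup>2 / real bh)"
    using err_0(2) err_Suc(2) err_step_integrable unfolding e_def d_def
    by (intro add_mono sum_mono) auto
  also have "\<dots> = \<sigma>\<^sup>2 / real bt + \<beta>\<^sup>2 * (\<Sum>t<m. e t) + ?K * (\<Sum>t<m. d t)
      + \<sigma>\<^sup>2 * (real m * (1 - \<beta>)\<^sup>2 / real bh)"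
    by (simp add: sum.distrib sum_distrib_left)
  \<comment> \<open>By \<open>tie2\<close> the noise of the \<open>m\<close> later rounds is at most
    that of the initial batch, which is the origin of the factor 2 in the result.\<close>
  also have "\<dots> \<le> \<sigma>\<^sup>2 / real bt + \<beta>\<^sup>2 * \<Sigma>e + ?K * \<Sigma>d + \<sigma>\<^sup>2 * (1 / real bt)"
    using sub tie2 by (intro add_mono mult_left_mono) auto
  also have "?K * \<Sigma>d \<le> \<beta>\<^sup>2 * L\<^sup>2 * (1 - \<beta>) * \<Sigma>d"
  proof -
    have "\<gamma>\<^sup>2 / real b \<le> 1 - \<beta>" using tie1 sizes by (simp add: field_simps)
    from mult_left_mono[OF this, of "\<beta>\<^sup>2 * L\<^sup>2"] show ?thesis using \<Sigma>0 by (intro mult_right_mono) auto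
  qed
  finally have "\<Sigma>e \<le> \<sigma>\<^sup>2 / real bt + \<beta>\<^sup>2 * \<Sigma>e + \<beta>\<^sup>2 * L\<^sup>2 * (1 - \<beta>) * \<Sigma>d + \<sigma>\<^sup>2 * (1 / real bt)"
    by simp
  moreover have "(1 - \<beta>) * (2 * \<sigma>\<^sup>2 / (real bt * (1 - \<beta>))) = \<sigma>\<^sup>2 / real bt + \<sigma>\<^sup>2 * (1 / real bt)"
    using \<beta> by simp
  moreover have "(1 - \<beta>) * ((1 + \<beta>) * \<Sigma>e) = \<Sigma>e - \<beta>\<^sup>2 * \<Sigma>e"
    by (simp add: algebra_simps power2_eq_square)
  moreover have "(1 - \<beta>) * (\<beta>\<^sup>2 * L\<^sup>2 * \<Sigma>d) = \<beta>\<^sup>2 * L\<^sup>2 * (1 - \<beta>) * \<Sigma>d" by simp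
  \<comment> \<open>Every term is brought to carry a factor \<open>1 - \<beta>\<close>: on the left
    from \<open>1 - \<beta>\<^sup>2\<close>, in the step term from \<open>tie1\<close>. Cancelling
    it keeps the coefficient of the step sum bounded however close \<open>\<beta>\<close> is to
    1.\<close>
  ultimately have "(1 - \<beta>) * ((1 + \<beta>) * \<Sigma>e)
      \<le> (1 - \<beta>) * (2 * \<sigma>\<^sup>2 / (real bt * (1 - \<beta>)) + \<beta>\<^sup>2 * L\<^sup>2 * \<Sigma>d)"
    unfolding distrib_left[of "1 - \<beta>" "2 * \<sigma>\<^sup>2 / (real bt * (1 - \<beta>))"] by linarith
  then have main: "(1 + \<beta>) * \<Sigma>e \<le> 2 * \<sigma>\<^sup>2 / (real bt * (1 - \<beta>)) + \<beta>\<^sup>2 * L\<^sup>2 * \<Sigma>d"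
    using \<beta> by simp
  \<comment> \<open>This turns the remaining factor \<open>1 + \<beta>\<close> into the coefficient
    1/2 of the step sum.\<close>
  have "\<beta>\<^sup>2 \<le> (1 + \<beta>) / 2"
    using mult_left_mono[of \<beta> 1 \<beta>] \<beta> by (simp add: power2_eq_square)
  then have "\<beta>\<^sup>2 * (L\<^sup>2 * \<Sigma>d) \<le> (1 + \<beta>) / 2 * (L\<^sup>2 * \<Sigma>d)"
    using \<Sigma>0 by (intro mult_right_mono) auto
  then have "\<beta>\<^sup>2 * L\<^sup>2 * \<Sigma>d \<le> (1 + \<beta>) * (L\<^sup>2 / 2 * \<Sigma>d)" by (simp add: mult.assoc)
  moreover have "1 * (2 * \<sigma>\<^sup>2 / (real bt * (1 - \<beta>))) \<le> (1 + \<beta>) * (2 * \<sigma>\<^sup>2 / (real bt * (1 - \<beta>)))"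
    using \<beta> by (intro mult_right_mono) auto
  ultimately have "(1 + \<beta>) * \<Sigma>e \<le> (1 + \<beta>) * (2 * \<sigma>\<^sup>2 / (real bt * (1 - \<beta>)) + L\<^sup>2 / 2 * \<Sigma>d)"
    using main unfolding distrib_left[of "1 + \<beta>" "2 * \<sigma>\<^sup>2 / (real bt * (1 - \<beta>))"] by linarith
  then have "\<Sigma>e \<le> 2 * \<sigma>\<^sup>2 / (real bt * (1 - \<beta>)) + L\<^sup>2 / 2 * \<Sigma>d"
    using \<beta> by simp
  then show ?thesis by (simp add: \<Sigma>e_def \<Sigma>d_def e_def d_def)
qed

lemma sum_gmap_le:
  assumes tie1: "\<gamma>\<^sup>2 \<le> real b * (1 - \<beta>)" and tie2: "real m * (1 - \<beta>)\<^sup>2 / real bh \<le> 1 / real bt"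
  shows "(\<Sum>t\<le>m. M.expectation (\<lambda>\<omega>. (norm (gmap (X t (samples \<omega>))))\<^sup>2))
    \<le> 12 * L * (f x\<^sub>0 + real_of_ereal (\<psi> x\<^sub>0) - F_low) / \<gamma> + 16 * \<sigma>\<^sup>2 / (real bt * (1 - \<beta>))"
proof -
  let ?D = "f x\<^sub>0 + real_of_ereal (\<psi> x\<^sub>0) - F_low"
  define A where "A = 2 * \<sigma>\<^sup>2 / (real bt * (1 - \<beta>))"
  define \<Sigma>e where "\<Sigma>e = (\<Sum>t\<le>m. M.expectation (\<lambda>\<omega>. err t (samples \<omega>)))"
  define \<Sigma>d where "\<Sigma>d = (\<Sum>t\<le>m. M.expectation (\<lambda>\<omega>. step t (samples \<omega>)))"
  note int = err_step_integrable
  have "\<gamma> * (L * \<Sigma>d - \<Sigma>e / (2 * L))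
      = \<gamma> * (\<Sum>t\<le>m. M.expectation (\<lambda>\<omega>. L * step t (samples \<omega>) - err t (samples \<omega>) / (2 * L)))"
    unfolding \<Sigma>d_def \<Sigma>e_def using int by (simp add: sum_subtractf sum_distrib_left sum_divide_distrib)
  \<comment> \<open>Summation up to \<open>m\<close> inclusive telescopes to the iterate with index
    \<open>m + 1\<close>, which is still determined by the samples of rounds up to
    \<open>m\<close>.\<close>
  also have "\<dots> = M.expectation (\<lambda>\<omega>. \<gamma> * (\<Sum>t<Suc m. L * step t (samples \<omega>) - err t (samples \<omega>) / (2 * L)))"
    unfolding lessThan_Suc_atMost using int by simp
  also have "\<dots> \<le> M.expectation (\<lambda>\<omega>. ?D)"
    using int by (intro integral_mono sum_objective_decrease) (auto simp del: sum.lessThan_Suc)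
  finally have "L * \<Sigma>d - \<Sigma>e / (2 * L) \<le> ?D / \<gamma>"
    using \<gamma> by (simp add: M.prob_space pos_le_divide_eq mult.commute)
  then have "L * (L * \<Sigma>d - \<Sigma>e / (2 * L)) \<le> L * (?D / \<gamma>)"
    using L by (intro mult_left_mono) auto
  then have 1: "L\<^sup>2 * \<Sigma>d - \<Sigma>e / 2 \<le> L * ?D / \<gamma>"
    using L by (simp add: algebra_simps power2_eq_square)
  have 2: "\<Sigma>e \<le> A + L\<^sup>2 * \<Sigma>d / 2"
    using sum_err_le[OF assms] by (simp add: \<Sigma>e_def \<Sigma>d_def A_def)
  have "(\<Sum>t\<le>m. M.expectation (\<lambda>\<omega>. (norm (gmap (X t (samples \<omega>))))\<^sup>2))
      \<le> (\<Sum>t\<le>m. M.expectation (\<lambda>\<omega>. 8 * L\<^sup>2 * step t (samples \<omega>) + 2 * err t (samples \<omega>)))"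
    using int by (intro sum_mono integral_mono norm_gmap_le gmap_integrable) auto
  also have "\<dots> = 8 * (L\<^sup>2 * \<Sigma>d) + 2 * \<Sigma>e"
    unfolding \<Sigma>d_def \<Sigma>e_def using int by (simp add: sum.distrib sum_distrib_left mult.assoc)
  \<comment> \<open>12 and 8 are the multipliers of facts \<open>1\<close> and \<open>2\<close>
    whose combination reproduces the coefficients 8 and 2: 12 - 8/2 = 8 and 8 - 12/2 = 2.\<close>
  also have "\<dots> \<le> 12 * (L * ?D / \<gamma>) + 8 * A" using 1 2 by linarith
  finally show ?thesis by (simp add: A_def mult.assoc)
qed

end

section \<open>Convergence and complexity\<close>

theorem theorem4:
  fixes P :: "'s measure" and M :: "'w measure"
    and f\<xi> :: "'s \<Rightarrow> real ^ 'p \<Rightarrow> real" and f :: "real ^ 'p \<Rightarrow> real"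
    and \<psi> F :: "real ^ 'p \<Rightarrow> ereal" and Fstar :: ereal
    and L \<sigma> c\<^sub>0 \<beta> \<gamma> \<eta> :: real
    and b bh bt m :: nat
    and x\<^sub>0 :: "real ^ 'p"
    and S :: "sample_index \<Rightarrow> 'w \<Rightarrow> 's" and \<tau> :: "'w \<Rightarrow> nat"
    and x :: "nat \<Rightarrow> 'w \<Rightarrow> real ^ 'p" and xbar :: "'w \<Rightarrow> real ^ 'p"
  assumes P: "prob_space P"
    and smooth: "\<And>\<xi>. \<xi> \<in> space P \<Longrightarrow> f\<xi> \<xi> differentiable_on UNIV \<and> continuous_on UNIV (grad (f\<xi> \<xi>))"
    and f_int: "\<And>y. integrable P (\<lambda>\<xi>. f\<xi> \<xi> y)"
    and f_eq: "\<And>y. f y = (\<integral>\<xi>. f\<xi> \<xi> y \<partial>P)"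
    and f_diff: "f differentiable_on UNIV"
    and unbiased: "\<And>y. integrable P (\<lambda>\<xi>. grad (f\<xi> \<xi>) y) \<and> (\<integral>\<xi>. grad (f\<xi> \<xi>) y \<partial>P) = grad f y"
    and F_eq: "\<And>y. F y = ereal (f y) + \<psi> y"
    and Fstar_eq: "Fstar = (INF y. F y)"
    and A1: "proper_fun \<psi>" "closed_fun \<psi>" "convex_fun \<psi>" "ext_dom F \<noteq> {}" "Fstar > -\<infinity>"
    and L: "0 < L"
    and A2: "\<And>y z. y \<in> ext_dom F \<Longrightarrow> z \<in> ext_dom F \<Longrightarrow>
          integrable P (\<lambda>\<xi>. (norm (grad (f\<xi> \<xi>) y - grad (f\<xi> \<xi>) z))\<^sup>2) \<and>
          (\<integral>\<xi>. (norm (grad (f\<xi> \<xi>) y - grad (f\<xi> \<xi>) z))\<^sup>2 \<partial>P) \<le> L\<^sup>2 * (norm (y - z))\<^sup>2"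
    and \<sigma>: "0 \<le> \<sigma>"
    and A3: "\<And>y. y \<in> ext_dom F \<Longrightarrow>
          integrable P (\<lambda>\<xi>. (norm (grad (f\<xi> \<xi>) y - grad f y))\<^sup>2) \<and>
          (\<integral>\<xi>. (norm (grad (f\<xi> \<xi>) y - grad f y))\<^sup>2 \<partial>P) \<le> \<sigma>\<^sup>2"
    and sizes: "1 \<le> b" "1 \<le> bt" "1 \<le> bh" "bh \<le> bt * (m + 1)"
    and c\<^sub>0: "0 < c\<^sub>0" "c\<^sub>0 \<le> sqrt 13 / (3 * sqrt (real b))"
    and \<beta>_eq: "\<beta> = 1 - sqrt (real bh) / sqrt (real bt * (real m + 1))"
    and \<gamma>_eq: "\<gamma> = 3 * c\<^sub>0 * real bh powr (1/4) * sqrt (real b)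
                   / (sqrt 13 * (real bt * (real m + 1)) powr (1/4))"
    and \<eta>_eq: "\<eta> = 2 / (L * (3 + \<gamma>))"
    and M: "prob_space M"
    and S_indep: "prob_space.indep_vars M (\<lambda>_. P) S (sample_indices bt b bh m)"
    and S_distr: "\<And>i. i \<in> sample_indices bt b bh m \<Longrightarrow> distr M P (S i) = P"
    and x\<^sub>0: "x\<^sub>0 \<in> ext_dom F"
    and x_eq: "\<And>t \<omega>. x t \<omega> = hsgd_x (\<lambda>\<xi>. grad (f\<xi> \<xi>)) \<psi> x\<^sub>0 bt b bh
                                (\<lambda>_. \<beta>) (\<lambda>_. \<gamma>) (\<lambda>_. \<eta>) (\<lambda>i. S i \<omega>) t"
    and \<tau>_indep: "indep_rvs M (count_space {0..m}) \<tau>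
          (PiM (sample_indices bt b bh m) (\<lambda>_. P)) (\<lambda>\<omega>. \<lambda>i\<in>sample_indices bt b bh m. S i \<omega>)"
    and \<tau>_distr: "distr M (count_space {0..m}) \<tau> = uniform_count_measure {0..m}"
    and xbar_eq: "\<And>\<omega>. xbar \<omega> = x (\<tau> \<omega>) \<omega>"
  shows
    "(0 \<le> \<beta> \<and> \<beta> < 1 \<and> 0 < \<gamma> \<and> \<gamma> \<le> 1 \<and> 1 / (2 * L) \<le> \<eta> \<and> \<eta> \<le> 2 / (3 * L))
     \<and>
     (integrable M (\<lambda>\<omega>. (norm (grad_map \<eta> \<psi> f (xbar \<omega>)))\<^sup>2) \<and>
      (\<integral>\<omega>. (norm (grad_map \<eta> \<psi> f (xbar \<omega>)))\<^sup>2 \<partial>M)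
        \<le> 16 * sqrt 13 * L * real bt powr (1/4) * real_of_ereal (F x\<^sub>0 - Fstar)
            / (3 * c\<^sub>0 * real bh powr (1/4) * sqrt (real b) * (real m + 1) powr (3/4))
          + 208 * \<sigma>\<^sup>2 / (9 * sqrt (real bh * real bt * (real m + 1))))
     \<and>
     (\<forall>c\<^sub>1::real. bh = b \<and> real bt = c\<^sub>1\<^sup>2 * (real b * (real m + 1)) powr (1/3)
         \<and> c\<^sub>1 \<ge> real b powr (1/3) / (real m + 1) powr (2/3) \<longrightarrow>
       \<gamma> = 3 * c\<^sub>0 * real b powr (2/3) / (sqrt (13 * c\<^sub>1) * (real m + 1) powr (1/3))
       \<and>
       (\<forall>\<epsilon>>0.
          let \<Delta>\<^sub>0 = 16 / 3 * (sqrt (13 * c\<^sub>1) * L * real_of_ereal (F x\<^sub>0 - Fstar) / c\<^sub>0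
                            + 13 * \<sigma>\<^sup>2 / (3 * c\<^sub>1));
              N = \<lfloor>\<Delta>\<^sub>0 powr (3/2) / (real b * \<epsilon> ^ 3)\<rfloor>;
              T = \<lfloor>c\<^sub>1\<^sup>2 * sqrt \<Delta>\<^sub>0 / \<epsilon> + 3 * \<Delta>\<^sub>0 powr (3/2) / \<epsilon> ^ 3\<rfloor>
          in
            (N \<le> int m \<or> real b * (real m + 1) = \<Delta>\<^sub>0 powr (3/2) / \<epsilon> ^ 3 \<longrightarrow>
               (\<integral>\<omega>. (norm (grad_map \<eta> \<psi> f (xbar \<omega>)))\<^sup>2 \<partial>M) \<le> \<epsilon>\<^sup>2)
            \<and> prox_count m = m
            \<and> (real b * (real m + 1) \<le> \<Delta>\<^sub>0 powr (3/2) / \<epsilon> ^ 3 \<longrightarrow>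
                 int (prox_count m) \<le> N
                 \<and> grad_count (real bt) (real b) (real m + 1) \<le> real_of_int T)
            \<and> (\<forall>b' M'. real b * M' = \<Delta>\<^sub>0 powr (3/2) / \<epsilon> ^ 3 \<and> b' = c\<^sub>1\<^sup>2 * (real b * M') powr (1/3) \<longrightarrow>
                 \<lfloor>grad_count b' (real b) M'\<rfloor> \<le> T)))"
proof -
  let ?g = "\<lambda>\<xi>. grad (f\<xi> \<xi>)" and ?D = "real_of_ereal (F x\<^sub>0 - Fstar)"
  have dom: "ext_dom F = ext_dom \<psi>" by (auto simp: ext_dom_def F_eq)
  have F_real: "F y = ereal (f y + real_of_ereal (\<psi> y))" if "y \<in> ext_dom \<psi>" for y
    using proper_fun_finite[OF A1(1) that] unfolding F_eq by (metis plus_ereal.simps(1))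
  have Fstar_le: "Fstar \<le> F y" for y unfolding Fstar_eq by (rule INF_lower) simp
  have "Fstar \<noteq> \<infinity>" using Fstar_le[of x\<^sub>0] x\<^sub>0 by (auto simp: ext_dom_def)
  then obtain Fs where Fs: "Fstar = ereal Fs" using A1(5) by (cases Fstar) auto
  have low: "Fs \<le> f y + real_of_ereal (\<psi> y)" if "y \<in> ext_dom \<psi>" for y
    using Fstar_le[of y] unfolding Fs F_real[OF that] by simp
  have D: "?D = f x\<^sub>0 + real_of_ereal (\<psi> x\<^sub>0) - Fs" "0 \<le> ?D"
    using x\<^sub>0 low[of x\<^sub>0] unfolding dom by (simp_all add: Fs F_real)
  note params = hsgd_parameters[OF L sizes c\<^sub>0 \<beta>_eq \<gamma>_eq \<eta>_eq]
  interpret prox_hsgd P M ?g f "grad f" \<psi> Fs L \<sigma> \<beta> \<gamma> \<eta> b bh bt m x\<^sub>0 S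
  proof (rule prox_hsgd.intro)
    show "GDERIV f y :> grad f y" for y
      using f_diff by (intro gderiv_grad) (simp add: differentiable_on_def)
  qed (use P M smooth unbiased A1 low L A2 A3 sizes params(1) \<eta>_eq S_indep S_distr x\<^sub>0
        in \<open>simp_all add: dom\<close>)
  define E where "E = (\<integral>\<omega>. (norm (grad_map \<eta> \<psi> f (xbar \<omega>)))\<^sup>2 \<partial>M)"
  \<comment> \<open>The integrand is written as a function of the index and of the restricted
    samples, because this is the family from which \<open>\<tau>\<close> is independent.\<close>
  define q where "q t a = (norm (gmap (X t a)))\<^sup>2" for t a
  have q_past: "q t (past (idx m) \<omega>) = (norm (gmap (X t (samples \<omega>))))\<^sup>2" if "t \<le> m" for t \<omega>
    unfolding q_def iterates_past[OF idx_mono[OF that]] ..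
  have \<tau>: "\<tau> \<in> measurable M (count_space {0..m})" using \<tau>_indep by (simp add: indep_rvs_def)
  have \<tau>_le: "\<tau> \<omega> \<le> m" if "\<omega> \<in> space M" for \<omega>
    using measurable_space[OF \<tau> that] by simp
  \<comment> \<open>Only on \<open>space M\<close> is \<open>\<tau> \<omega>\<close> known to be at
    most \<open>m\<close>, so the equality is restricted to it.\<close>
  have xbar: "(norm (grad_map \<eta> \<psi> f (xbar \<omega>)))\<^sup>2 = q (\<tau> \<omega>) (past (idx m) \<omega>)" if "\<omega> \<in> space M" for \<omega>
    unfolding q_past[OF \<tau>_le[OF that]] by (simp only: xbar_eq x_eq X_def grad_map_def gmap_def)
  have q_meas: "q t \<in> borel_measurable (PiM (idx m) (\<lambda>_. P))" if "t \<le> m" for t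
    unfolding q_def[abs_def] by (rule measurable_err_step(3)[OF idx_mono[OF that]])
  have q_int: "integrable M (\<lambda>\<omega>. q t (past (idx m) \<omega>))" if "t \<le> m" for t
    unfolding q_past[OF that] by (rule gmap_integrable[OF that])
  have unif: "integrable M (\<lambda>\<omega>. q (\<tau> \<omega>) (past (idx m) \<omega>))"
    "M.expectation (\<lambda>\<omega>. q (\<tau> \<omega>) (past (idx m) \<omega>))
      = (\<Sum>t\<le>m. M.expectation (\<lambda>\<omega>. q t (past (idx m) \<omega>))) / (real m + 1)"
    by (rule M.expectation_uniform_index[where q = q, OF \<tau>_indep \<tau>_distr q_meas q_int]; assumption)+
  have integrable: "integrable M (\<lambda>\<omega>. (norm (grad_map \<eta> \<psi> f (xbar \<omega>)))\<^sup>2)"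
    using unif(1) by (subst Bochner_Integration.integrable_cong[OF refl xbar]) auto
  have "E = M.expectation (\<lambda>\<omega>. q (\<tau> \<omega>) (past (idx m) \<omega>))"
    unfolding E_def by (rule Bochner_Integration.integral_cong[OF refl xbar])
  also have "\<dots> = (\<Sum>t\<le>m. M.expectation (\<lambda>\<omega>. (norm (gmap (X t (samples \<omega>))))\<^sup>2)) / (real m + 1)"
    unfolding unif(2) by (intro arg_cong2[where f = "(/)"] sum.cong refl) (simp add: q_past)
  also have "\<dots> \<le> (12 * L * ?D / \<gamma> + 16 * \<sigma>\<^sup>2 / (real bt * (1 - \<beta>))) / (real m + 1)"
    unfolding D(1) by (intro divide_right_mono sum_gmap_le params) simp
  also have "\<dots> = 12 * L * ?D / (\<gamma> * (real m + 1)) + 16 * \<sigma>\<^sup>2 / (real bt * (1 - \<beta>) * (real m + 1))"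
    by (simp add: add_divide_distrib)
  \<comment> \<open>The constants 12 and 16 obtained so far are relaxed to the claimed 16 and 208/9;
    for the first this uses that the initial gap \<open>?D\<close> is nonnegative.\<close>
  also have "\<dots> \<le> 16 * L * ?D / (\<gamma> * (real m + 1)) + 208 / 9 * \<sigma>\<^sup>2 / (real bt * (1 - \<beta>) * (real m + 1))"
    using L D(2) params(1) by (intro add_mono divide_right_mono mult_right_mono) auto
  finally have bound: "E \<le> 16 * sqrt 13 * L * real bt powr (1/4) * ?D
            / (3 * c\<^sub>0 * real bh powr (1/4) * sqrt (real b) * (real m + 1) powr (3/4))
          + 208 * \<sigma>\<^sup>2 / (9 * sqrt (real bh * real bt * (real m + 1)))"
    unfolding params(4,5) by (simp add: ac_simps)
  have partc: "\<gamma> = 3 * c\<^sub>0 * real b powr (2/3) / (sqrt (13 * c\<^sub>1) * (real m + 1) powr (1/3))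
       \<and>
       (\<forall>\<epsilon>>0.
          let \<Delta>\<^sub>0 = 16 / 3 * (sqrt (13 * c\<^sub>1) * L * ?D / c\<^sub>0 + 13 * \<sigma>\<^sup>2 / (3 * c\<^sub>1));
              N = \<lfloor>\<Delta>\<^sub>0 powr (3/2) / (real b * \<epsilon> ^ 3)\<rfloor>;
              T = \<lfloor>c\<^sub>1\<^sup>2 * sqrt \<Delta>\<^sub>0 / \<epsilon> + 3 * \<Delta>\<^sub>0 powr (3/2) / \<epsilon> ^ 3\<rfloor>
          in
            (N \<le> int m \<or> real b * (real m + 1) = \<Delta>\<^sub>0 powr (3/2) / \<epsilon> ^ 3 \<longrightarrow> E \<le> \<epsilon>\<^sup>2)
            \<and> prox_count m = m
            \<and> (real b * (real m + 1) \<le> \<Delta>\<^sub>0 powr (3/2) / \<epsilon> ^ 3 \<longrightarrow>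
                 int (prox_count m) \<le> N
                 \<and> grad_count (real bt) (real b) (real m + 1) \<le> real_of_int T)
            \<and> (\<forall>b' M'. real b * M' = \<Delta>\<^sub>0 powr (3/2) / \<epsilon> ^ 3 \<and> b' = c\<^sub>1\<^sup>2 * (real b * M') powr (1/3) \<longrightarrow>
                 \<lfloor>grad_count b' (real b) M'\<rfloor> \<le> T))"
    if "bh = b" and bt: "real bt = c\<^sub>1\<^sup>2 * (real b * (real m + 1)) powr (1/3)"
      and c\<^sub>1: "c\<^sub>1 \<ge> real b powr (1/3) / (real m + 1) powr (2/3)" for c\<^sub>1
  proof -
    \<comment> \<open>With \<open>bh = b\<close> and this \<open>bt\<close>, the lower bound on
      \<open>c\<^sub>1\<close> expresses that \<open>bh\<close> is at most
      \<open>bt (m + 1)\<close>; here it yields positivity of \<open>c\<^sub>1\<close>.\<close>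
    have "0 < real b powr (1/3) / (real m + 1) powr (2/3)" using sizes(1) by simp
    with c\<^sub>1 have c\<^sub>1_pos: "0 < c\<^sub>1" by linarith
    note mb = mini_batch_bounds[OF sizes(1) c\<^sub>0(1) c\<^sub>1_pos bt]
    define \<Delta> where "\<Delta> = 16 / 3 * (sqrt (13 * c\<^sub>1) * L * ?D / c\<^sub>0 + 13 * \<sigma>\<^sup>2 / (3 * c\<^sub>1))"
    have \<Delta>: "0 \<le> \<Delta>" unfolding \<Delta>_def using c\<^sub>1_pos L D(2) c\<^sub>0(1) by simp
    define K where "K = real b * (real m + 1)"
    have K: "0 < K" using sizes(1) by (simp add: K_def)
    \<comment> \<open>After this, accuracy depends only on the single quantity \<open>K\<close>, to
      be compared with its target \<open>Q\<close>.\<close>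
    have E\<Delta>: "E \<le> \<Delta> / K powr (2/3)"
      using bound unfolding \<open>bh = b\<close> mb(2) by (simp add: \<Delta>_def K_def)
    have count: "prox_count m = m" by (simp add: prox_count_def)
    have "(\<lfloor>\<Delta> powr (3/2) / (real b * \<epsilon> ^ 3)\<rfloor> \<le> int m \<or> K = \<Delta> powr (3/2) / \<epsilon> ^ 3 \<longrightarrow> E \<le> \<epsilon>\<^sup>2)
      \<and> (K \<le> \<Delta> powr (3/2) / \<epsilon> ^ 3 \<longrightarrow>
           int m \<le> \<lfloor>\<Delta> powr (3/2) / (real b * \<epsilon> ^ 3)\<rfloor>
           \<and> grad_count (real bt) (real b) (real m + 1)
               \<le> real_of_int \<lfloor>c\<^sub>1\<^sup>2 * sqrt \<Delta> / \<epsilon> + 3 * \<Delta> powr (3/2) / \<epsilon> ^ 3\<rfloor>)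
      \<and> (\<forall>b' M'. real b * M' = \<Delta> powr (3/2) / \<epsilon> ^ 3 \<and> b' = c\<^sub>1\<^sup>2 * (real b * M') powr (1/3) \<longrightarrow>
           \<lfloor>grad_count b' (real b) M'\<rfloor> \<le> \<lfloor>c\<^sub>1\<^sup>2 * sqrt \<Delta> / \<epsilon> + 3 * \<Delta> powr (3/2) / \<epsilon> ^ 3\<rfloor>)"
      if \<epsilon>: "0 < \<epsilon>" for \<epsilon>
    proof (intro conjI impI allI)
      define Q where "Q = \<Delta> powr (3/2) / \<epsilon> ^ 3"
      have Q0: "0 \<le> Q" using \<epsilon> by (simp add: Q_def)
      have Q: "Q powr (1/3) = sqrt \<Delta> / \<epsilon>" "Q powr (2/3) = \<Delta> / \<epsilon>\<^sup>2"
        unfolding Q_def by (rule powr_three_halves_scaled[OF \<Delta> \<epsilon>])+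
      have Qb: "\<Delta> powr (3/2) / (real b * \<epsilon> ^ 3) = Q / real b" by (simp add: Q_def)
      have T: "c\<^sub>1\<^sup>2 * sqrt \<Delta> / \<epsilon> + 3 * \<Delta> powr (3/2) / \<epsilon> ^ 3 = c\<^sub>1\<^sup>2 * Q powr (1/3) + 3 * Q"
        unfolding Q by (simp add: Q_def)
      show "E \<le> \<epsilon>\<^sup>2"
        if "\<lfloor>\<Delta> powr (3/2) / (real b * \<epsilon> ^ 3)\<rfloor> \<le> int m \<or> K = \<Delta> powr (3/2) / \<epsilon> ^ 3"
      proof -
        \<comment> \<open>Rounding down is harmless: if the floor of \<open>Q / b\<close> is at most
          \<open>m\<close>, then \<open>Q / b\<close> lies below \<open>m + 1\<close>, and
          \<open>K\<close> counts \<open>m + 1\<close> rounds.\<close>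
        have "Q \<le> K"
          using that unfolding Qb Q_def[symmetric]
        proof
          assume "\<lfloor>Q / real b\<rfloor> \<le> int m"
          then have "Q / real b < real m + 1" by linarith
          then show "Q \<le> K" using sizes(1) by (simp add: K_def field_simps)
        qed simp
        then have "\<Delta> / \<epsilon>\<^sup>2 \<le> K powr (2/3)" unfolding Q(2)[symmetric] using Q0 by (intro powr_mono2) auto
        then have "\<Delta> / K powr (2/3) \<le> \<epsilon>\<^sup>2" using K \<epsilon> by (simp add: field_simps)
        with E\<Delta> show ?thesis by linarith
      qed
      show "int m \<le> \<lfloor>\<Delta> powr (3/2) / (real b * \<epsilon> ^ 3)\<rfloor>" if "K \<le> \<Delta> powr (3/2) / \<epsilon> ^ 3"
      proof -
        have "real m + 1 \<le> Q / real b"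
          using that sizes(1) by (simp add: K_def Q_def[symmetric] field_simps)
        then show ?thesis unfolding Qb by linarith
      qed
      show "grad_count (real bt) (real b) (real m + 1)
          \<le> real_of_int \<lfloor>c\<^sub>1\<^sup>2 * sqrt \<Delta> / \<epsilon> + 3 * \<Delta> powr (3/2) / \<epsilon> ^ 3\<rfloor>"
        if "K \<le> \<Delta> powr (3/2) / \<epsilon> ^ 3"
      proof -
        have KQ: "K \<le> Q" using that by (simp add: Q_def)
        have "real bt \<le> c\<^sub>1\<^sup>2 * Q powr (1/3)"
          unfolding bt K_def[symmetric] using K KQ by (intro mult_left_mono powr_mono2) auto
        \<comment> \<open>For an actual run the count is an integer, so a real upper bound on it may
          be replaced by its floor.\<close>
        with KQ have "real_of_int (int (bt + 3 * b * (m + 1))) \<le> c\<^sub>1\<^sup>2 * Q powr (1/3) + 3 * Q"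
          by (simp add: K_def algebra_simps)
        then have "int (bt + 3 * b * (m + 1)) \<le> \<lfloor>c\<^sub>1\<^sup>2 * Q powr (1/3) + 3 * Q\<rfloor>"
          by (simp only: le_floor_iff)
        then have "real_of_int (int (bt + 3 * b * (m + 1))) \<le> real_of_int \<lfloor>c\<^sub>1\<^sup>2 * Q powr (1/3) + 3 * Q\<rfloor>"
          by (simp only: of_int_le_iff)
        then show ?thesis unfolding T by (simp add: grad_count_def algebra_simps)
      qed
      \<comment> \<open>Rounding is ignored for the arguments here: \<open>b'\<close> and
        \<open>M'\<close> are the real solutions of the defining equations, and the two numbers
        under the floors coincide.\<close>
      show "\<lfloor>grad_count b' (real b) M'\<rfloor> \<le> \<lfloor>c\<^sub>1\<^sup>2 * sqrt \<Delta> / \<epsilon> + 3 * \<Delta> powr (3/2) / \<epsilon> ^ 3\<rfloor>"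
        if "real b * M' = \<Delta> powr (3/2) / \<epsilon> ^ 3 \<and> b' = c\<^sub>1\<^sup>2 * (real b * M') powr (1/3)" for b' M'
        using that unfolding T Q_def[symmetric] grad_count_def by (simp add: mult.assoc)
    qed
    moreover have "\<gamma> = 3 * c\<^sub>0 * real b powr (2/3) / (sqrt (13 * c\<^sub>1) * (real m + 1) powr (1/3))"
      unfolding \<gamma>_eq \<open>bh = b\<close> by (rule mb(1))
    ultimately show ?thesis
      unfolding Let_def \<Delta>_def[symmetric] K_def[symmetric] count by blast
  qed
  show ?thesis
    unfolding E_def[symmetric] using params(1) integrable bound partc by blast
qed

end
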